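(* Fix $\Delta\in(0,1)$. For each $n\ge 2$ let $a_1=1$ and let $a_2,\dots,a_n$ (the overlaps) be independent random variables in $[0,1]$ with common probability density $\tilde f$, and put $f(x)=\tilde f(1-x)$. Let $N_\Delta$ be the number of steps it takes for the student following the memoryless learner algorithm (with $n$ concepts, overlaps $a_i$, and uniformly random initial guess) to have probability at least $1-\Delta$ of having learned the correct concept. Then: 1. If the distribution of overlaps is uniform or, more generally, $f(x)=c+O(x^{\delta})$ as $x\to 0^+$ with $c,\delta>0$, then there exist positive constants $C_1,C_2$ such that $$\lim_{n\to\infty}\mathbf P\left(C_1<\frac{N_\Delta}{|\log\Delta|\,n\log n}<C_2\right)=1.$$ 2. If $f(x)=c x^{\beta}+O(x^{\beta+\delta})$ as $x\to0^+$ with $c,\delta,\beta>0$, then there exist positive constants $C_1',C_2'$ such that $$\lim_{n\to\infty}\mathbf P\left(C_1'<\frac{N_\Delta}{|\log\Delta|\,n}<C_2'\right)=1.$$ 3. If $f(x)=c x^{\beta}+O(x^{\beta+\delta})$ as $x\to0^+$ with $c,\delta>0$ and $-1<\beta<0$, then $$\lim_{x\to\infty}\ \liminf_{n\to\infty}\ \mathbf P\left(\frac1x<\frac{N_\Delta}{|\log\Delta|\,n^{1/(1+\beta)}}<x\right)=1.$$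
   Context: Memoryless learner algorithm: there are $n$ concepts $R_1,\dots,R_n$, and $R_1$ is the correct one. The student's current guess evolves as a Markov chain on $\{1,\dots,n\}$ with transition matrix $T$ given by $T_{ii}=a_i$ and $T_{ij}=(1-a_i)/(n-1)$ for $j\ne i$, where $a_1=1$ (the correct guess is never rejected) and $a_i$, for $i\ge2$, is the probability that the teacher's example is consistent with concept $R_i$. The initial distribution is uniform, $\mathbf p^{(0)}=(1/n,\dots,1/n)^T$. After $N$ steps, the probability that the student's guess is correct is $Q_{11}(N)=[(\mathbf p^{(0)})^T T^N]_1$, and $N_\Delta$ is the least $N$ such that $1-Q_{11}(N)\le\Delta$. Since the $a_i$ are random, $T$, $Q_{11}(N)$ and $N_\Delta$ are random, and $\mathbf P$ refers to the randomness of the overlaps $a_i$. *)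

theory Defs
  imports "HOL-Probability.Probability" "HOL-Library.Landau_Symbols"
    "Jordan_Normal_Form.Matrix"
begin

(* Concepts are numbered 1..n, as are the overlaps a 1, ..., a n, whereas the rows and columns
   of a matrix are numbered from 0: row i belongs to concept Suc i. *)

definition transition_matrix :: "nat \<Rightarrow> (nat \<Rightarrow> real) \<Rightarrow> real mat" where
  "transition_matrix n a =
     Matrix.mat n n (\<lambda>(i, j). if i = j then a (Suc i) else (1 - a (Suc i)) / (real n - 1))"

definition initial_distribution :: "nat \<Rightarrow> real Matrix.vec" where
  "initial_distribution n = Matrix.vec n (\<lambda>_. 1 / real n)"

(* The row vector p\<^sup>T T\<^sup>N is written as the column vector (T\<^sup>N)\<^sup>T p;
   its entry 0 belongs to the correct concept. *)

definition prob_correct :: "nat \<Rightarrow> (nat \<Rightarrow> real) \<Rightarrow> nat \<Rightarrow> real" where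
  "prob_correct n a N =
     vec_index (transpose_mat (transition_matrix n a ^\<^sub>m N) *\<^sub>v initial_distribution n) 0"

(* If a i < 1 for all i in {2..n}, as holds almost surely when the overlaps have a density,
   then prob_correct n a N tends to 1 and the least N exists. *)

definition learning_time :: "nat \<Rightarrow> (nat \<Rightarrow> real) \<Rightarrow> real \<Rightarrow> nat" where
  "learning_time n a \<Delta> = (LEAST N. 1 - prob_correct n a N \<le> \<Delta>)"

end

theory Submission
  imports Defs "HOL-Real_Asymp.Real_Asymp"
begin

text \<open>
  Put \<open>x\<^sub>i = 1 - a\<^sub>i\<close>, write \<open>m\<^sub>N\<close> for the probability of not being at the correct concept after \<open>N\<close>
  steps, and let \<open>S\<close> be the sum of \<open>1 / x\<^sub>i\<close> over \<open>i \<ge> 2\<close>. The expected absorption time started at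
  \<open>i\<close> is \<open>(n - 1) / n * (1 / x\<^sub>i + S)\<close>, so \<open>m\<^sub>N \<le> S / (N + 1)\<close> and the learning time is less than
  \<open>S / \<Delta> + 1\<close>. Conversely, \<open>g\<^sub>i = 1 + min (\<mu> / x\<^sub>i) \<rho>\<close> for \<open>i \<ge> 2\<close>, \<open>g\<^sub>1 = 0\<close>, loses at most \<open>2 \<mu>\<close> in
  expectation per step as soon as the numbers \<open>min (\<mu> / x\<^sub>i) \<rho>\<close> sum up to at least \<open>1\<close>; taking
  \<open>\<rho> = (1 - \<Delta>) / 2\<close> this makes the learning time exceed \<open>\<rho> / (2 \<mu>)\<close>.

  It remains to locate \<open>S\<close> and the truncated sums. With high probability no \<open>x\<^sub>i\<close> lies below a
  level \<open>b\<close>. For \<open>\<beta> \<ge> 0\<close> there is such a level for which the sum of the variables \<open>1 / x\<^sub>i\<close> cut off at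
  \<open>b\<close> concentrates by Chebyshev's inequality around its mean, which is of order \<open>n ln n\<close> for \<open>\<beta> = 0\<close>
  and of order \<open>n\<close> for \<open>\<beta> > 0\<close>. For \<open>\<beta> < 0\<close> the smallest few \<open>x\<^sub>i\<close>, of size
  \<open>n powr (- 1 / (1 + \<beta>))\<close>, dominate \<open>S\<close>: Markov's inequality bounds \<open>S\<close> from above, and counting
  these \<open>x\<^sub>i\<close> gives the lower bound.
\<close>

section \<open>Deterministic bounds on the learning time\<close>


primrec guess_prob :: "nat \<Rightarrow> (nat \<Rightarrow> real) \<Rightarrow> nat \<Rightarrow> nat \<Rightarrow> real" where
  "guess_prob n a 0 j = 1 / real n"
| "guess_prob n a (Suc N) j =
     (\<Sum>i\<in>{1..n}. guess_prob n a N i * (if i = j then a i else (1 - a i) / (real n - 1)))"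

text \<open>Replaces matrices by a recursion over the concepts 1..n; index \<open>j\<close> of the
  vector is concept \<open>Suc j\<close>. The recursion appends the last transition, which is how
  \<open>pow_mat\<close> unfolds, so induction on \<open>N\<close> suffices.\<close>

lemma guess_prob_eq:
  assumes "j < n"
  shows "vec_index (transpose_mat (transition_matrix n a ^\<^sub>m N) *\<^sub>v initial_distribution n) j
           = guess_prob n a N (Suc j)"
proof -
  let ?T = "transition_matrix n a"
  have dim: "dim_row ?T = n" "dim_col ?T = n"
    by (simp_all add: transition_matrix_def)
  have entry: "vec_index (transpose_mat (?T ^\<^sub>m N) *\<^sub>v initial_distribution n) j
                 = (\<Sum>i<n. (?T ^\<^sub>m N) $$ (i, j) / real n)" if "j < n" for N j
    using that dim
    by (cases N) (simp_all add: scalar_prod_def initial_distribution_def lessThan_atLeast0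
        sum_divide_distrib[symmetric])
  have "(\<Sum>i<n. (?T ^\<^sub>m N) $$ (i, j) / real n) = guess_prob n a N (Suc j)" if "j < n" for j
    using that
  proof (induction N arbitrary: j)
    case 0
    then show ?case
      by (simp add: dim sum_divide_distrib[symmetric])
  next
    case (Suc N)
    have T: "?T $$ (k, j) = (if Suc k = Suc j then a (Suc k) else (1 - a (Suc k)) / (real n - 1))"
      if "k < n" for k
      using that Suc.prems by (simp add: transition_matrix_def)
    have mult: "(?T ^\<^sub>m Suc N) $$ (i, j) = (\<Sum>k<n. (?T ^\<^sub>m N) $$ (i, k) * ?T $$ (k, j))"
      if "i < n" for i
      using that Suc.prems dim
      by (cases N) (simp_all add: scalar_prod_def lessThan_atLeast0 if_distrib[of "\<lambda>x. x * _"]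
          cong: if_cong)
    have "(\<Sum>i<n. (?T ^\<^sub>m Suc N) $$ (i, j) / real n)
            = (\<Sum>i<n. \<Sum>k<n. (?T ^\<^sub>m N) $$ (i, k) / real n * ?T $$ (k, j))"
      by (intro sum.cong refl) (simp add: mult sum_divide_distrib del: pow_mat.simps)
    also have "\<dots> = (\<Sum>k<n. (\<Sum>i<n. (?T ^\<^sub>m N) $$ (i, k) / real n) * ?T $$ (k, j))"
      by (subst sum.swap) (simp add: sum_distrib_right)
    also have "\<dots> = (\<Sum>k<n. guess_prob n a N (Suc k) * ?T $$ (k, j))"
      by (intro sum.cong refl) (simp add: Suc.IH)
    also have "\<dots> = (\<Sum>k<n. guess_prob n a N (Suc k)
        * (if Suc k = Suc j then a (Suc k) else (1 - a (Suc k)) / (real n - 1)))"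
      by (intro sum.cong refl) (simp add: T del: nat.inject)
    also have "\<dots> = guess_prob n a (Suc N) (Suc j)"
      unfolding guess_prob.simps
      by (rule sum.reindex_bij_witness[of _ "\<lambda>i. i - 1" Suc]) auto
    finally show ?case .
  qed
  then show ?thesis
    using entry assms by simp
qed

lemma prob_correct_eq: "n > 0 \<Longrightarrow> prob_correct n a N = guess_prob n a N 1"
  by (simp add: prob_correct_def guess_prob_eq)

lemma guess_prob_nonneg:
  assumes "\<And>i. i \<in> {1..n} \<Longrightarrow> a i \<in> {0..1}"
  shows "0 \<le> guess_prob n a N j"
proof (induction N arbitrary: j)
  case (Suc N)
  show ?case
    unfolding guess_prob.simps
  proof (intro sum_nonneg mult_nonneg_nonneg Suc.IH)
    fix i assume "i \<in> {1..n}"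
    then show "0 \<le> (if i = j then a i else (1 - a i) / (real n - 1))"
      using assms[of i] by auto
  qed
qed simp

text \<open>Duality: the transition acts on the test function \<open>g\<close> instead of the
  distribution. All off-diagonal entries of row \<open>i\<close> agree, so the new value at
  \<open>i\<close> involves \<open>g\<close> only through \<open>g i\<close> and its total. The
  one-step estimates below are this identity for suitable \<open>g\<close>.\<close>

lemma guess_prob_expectation_Suc:
  assumes "n \<ge> 2"
  shows "(\<Sum>j\<in>{1..n}. guess_prob n a (Suc N) j * g j)
           = (\<Sum>i\<in>{1..n}. guess_prob n a N i
                * (g i + (1 - a i) * ((\<Sum>j\<in>{1..n}. g j) - real n * g i) / (real n - 1)))"
proof -
  have row: "(\<Sum>j\<in>{1..n}. (if i = j then a i else (1 - a i) / (real n - 1)) * g j)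
      = g i + (1 - a i) * ((\<Sum>j\<in>{1..n}. g j) - real n * g i) / (real n - 1)"
    if "i \<in> {1..n}" for i
  proof -
    have "(\<Sum>j\<in>{1..n}. (if i = j then a i else (1 - a i) / (real n - 1)) * g j)
        = a i * g i + (\<Sum>j\<in>{1..n} - {i}. (1 - a i) / (real n - 1) * g j)"
      using that by (subst sum.remove[of _ i]) (auto intro!: sum.cong)
    also have "\<dots> = a i * g i + (1 - a i) / (real n - 1) * ((\<Sum>j\<in>{1..n}. g j) - g i)"
      using that unfolding sum_distrib_left[symmetric] by (simp add: sum_diff1)
    also have "\<dots> = g i + (1 - a i) * ((\<Sum>j\<in>{1..n}. g j) - real n * g i) / (real n - 1)"
      using assms by (simp add: field_simps)
    finally show ?thesis .
  qed
  have "(\<Sum>j\<in>{1..n}. guess_prob n a (Suc N) j * g j)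
      = (\<Sum>i\<in>{1..n}. guess_prob n a N i
           * (\<Sum>j\<in>{1..n}. (if i = j then a i else (1 - a i) / (real n - 1)) * g j))"
    unfolding guess_prob.simps sum_distrib_right sum_distrib_left
    by (subst sum.swap) (simp add: mult_ac)
  also have "\<dots> = (\<Sum>i\<in>{1..n}. guess_prob n a N i
                * (g i + (1 - a i) * ((\<Sum>j\<in>{1..n}. g j) - real n * g i) / (real n - 1)))"
    by (intro sum.cong refl) (simp only: row)
  finally show ?thesis .
qed

lemma sum_guess_prob:
  assumes "n \<ge> 2"
  shows "(\<Sum>j\<in>{1..n}. guess_prob n a N j) = 1"
proof (induction N)
  case (Suc N)
  then show ?case
    using guess_prob_expectation_Suc[OF assms, of a N "\<lambda>_. 1"] by simp
qed (use assms in simp)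

text \<open>The index is written \<open>Suc 0\<close> because the simplifier turns \<open>1\<close>
  into it.\<close>

lemma sum_split_first:
  fixes g :: "nat \<Rightarrow> 'b::comm_monoid_add"
  assumes "n \<ge> 1"
  shows "(\<Sum>i\<in>{Suc 0..n}. g i) = g (Suc 0) + (\<Sum>i\<in>{2..n}. g i)"
  using assms by (subst sum.atLeast_Suc_atMost) (auto simp: numeral_2_eq_2)

lemma error_prob_eq:
  assumes "n \<ge> 2"
  shows "1 - prob_correct n a N = (\<Sum>i\<in>{2..n}. guess_prob n a N i)"
  using sum_guess_prob[OF assms, of a N] assms
  by (simp add: sum_split_first prob_correct_eq)

section \<open>Learning with a fixed realization of the overlaps\<close>

locale memoryless_learner =
  fixes n :: nat and a :: "nat \<Rightarrow> real"
  assumes n_ge_2: "n \<ge> 2"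
    and first_eq: "a 1 = 1"
    and overlap_range: "i \<in> {2..n} \<Longrightarrow> a i \<in> {0..1}"
begin

lemma overlap_bounds: "i \<in> {1..n} \<Longrightarrow> a i \<in> {0..1}"
  using overlap_range[of i] first_eq by (cases "i = 1") auto

lemma guess_prob_ge_0: "0 \<le> guess_prob n a N j"
  by (rule guess_prob_nonneg) (rule overlap_bounds)

lemma error_prob_Suc_le: "1 - prob_correct n a (Suc N) \<le> 1 - prob_correct n a N"
proof -
  \<comment> \<open>The indicator of the correct concept: its expectation is
    \<open>prob_correct\<close>, and since concept 1 is absorbing, a step cannot lower it.\<close>
  define G where "G = (\<lambda>i::nat. if i = 1 then 1 else 0 :: real)"
  have G: "(\<Sum>j\<in>{1..n}. G j) = 1"
    using n_ge_2 by (simp add: G_def)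
  have val: "(\<Sum>j\<in>{1..n}. guess_prob n a N j * G j) = prob_correct n a N" for N
    using n_ge_2 by (simp add: G_def prob_correct_eq if_distrib cong: if_cong)
  have "prob_correct n a N \<le> prob_correct n a (Suc N)"
    unfolding val[symmetric] guess_prob_expectation_Suc[OF n_ge_2] G
  proof (intro sum_mono mult_left_mono guess_prob_ge_0)
    fix i assume i: "i \<in> {1..n}"
    show "G i \<le> G i + (1 - a i) * (1 - real n * G i) / (real n - 1)"
      using overlap_bounds[OF i] first_eq n_ge_2 by (auto simp: G_def)
  qed
  then show ?thesis
    by simp
qed

lemma error_prob_antimono: "N \<le> N' \<Longrightarrow> 1 - prob_correct n a N' \<le> 1 - prob_correct n a N"
  by (rule lift_Suc_antimono_le[of "\<lambda>N. 1 - prob_correct n a N"]) (rule error_prob_Suc_le)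

text \<open>The function \<open>h\<close> below solves a Poisson equation: one step lowers it by
  exactly 1 off concept 1. Its expectation thus decreases by the current error probability, and
  telescoping bounds the sum of the error probabilities by the initial expectation, which is at most
  \<open>S\<close>.\<close>

lemma error_prob_le:
  assumes lt1: "\<And>i. i \<in> {2..n} \<Longrightarrow> a i < 1"
  shows "1 - prob_correct n a N \<le> (\<Sum>i\<in>{2..n}. 1 / (1 - a i)) / real (Suc N)"
proof -
  define S where "S = (\<Sum>i\<in>{2..n}. 1 / (1 - a i))"
  \<comment> \<open>For \<open>i\<close> other than 1, the Poisson equation asks that
    \<open>n * h i\<close> exceed the total of \<open>h\<close> by
    \<open>(n - 1) / (1 - a i)\<close>; the total then comes out as
    \<open>(n - 1) * S\<close>.\<close>
  define h where "h = (\<lambda>i. if i = 1 then 0 else (real n - 1) / real n * (1 / (1 - a i) + S))"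
  define V where "V = (\<lambda>N. \<Sum>j\<in>{1..n}. guess_prob n a N j * h j)"
  have S0: "0 \<le> S"
    unfolding S_def using lt1 by (intro sum_nonneg) (simp add: less_imp_le)
  have h0: "0 \<le> h i" if "i \<in> {1..n}" for i
  proof (cases "i = 1")
    case False
    then show ?thesis
      using that S0 lt1[of i] n_ge_2 unfolding h_def by (auto simp: less_imp_le)
  qed (simp add: h_def)
  have card: "real (card {2..n}) = real n - 1"
    using n_ge_2 by (simp add: of_nat_diff)
  have sum_h: "(\<Sum>j\<in>{1..n}. h j) = (real n - 1) * S"
  proof -
    have "(\<Sum>j\<in>{1..n}. h j) = (\<Sum>j\<in>{2..n}. (real n - 1) / real n * (1 / (1 - a j) + S))"
      using n_ge_2 by (simp add: sum_split_first h_def)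
    also have "\<dots> = (real n - 1) / real n * (S + (real n - 1) * S)"
      by (simp only: sum_distrib_left[symmetric] sum.distrib sum_constant card S_def)
    also have "\<dots> = (real n - 1) * S"
      using n_ge_2 by (simp add: field_simps)
    finally show ?thesis .
  qed
  have step: "h i + (1 - a i) * ((\<Sum>j\<in>{1..n}. h j) - real n * h i) / (real n - 1)
                = h i - (if i = 1 then 0 else 1)" if i: "i \<in> {1..n}" for i
  proof (cases "i = 1")
    case True
    then show ?thesis using first_eq by simp
  next
    case False
    then have "1 - a i \<noteq> 0"
      using lt1[of i] i by auto
    moreover have "(real n - 1) * S - (real n - 1) * (1 / (1 - a i) + S) = - ((real n - 1) / (1 - a i))"
      by (simp add: algebra_simps)
    ultimately have "(1 - a i) * ((real n - 1) * S - (real n - 1) * (1 / (1 - a i) + S)) / (real n - 1) = -1"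
      using n_ge_2 by (simp add: divide_eq_minus_1_iff)
    moreover have "real n * h i = (real n - 1) * (1 / (1 - a i) + S)"
      using False n_ge_2 by (simp add: h_def)
    ultimately show ?thesis
      using False unfolding sum_h by simp
  qed
  have V_Suc: "V (Suc N) = V N - (1 - prob_correct n a N)" for N
  proof -
    have "V (Suc N) = (\<Sum>i\<in>{1..n}. guess_prob n a N i * (h i - (if i = 1 then 0 else 1)))"
      unfolding V_def guess_prob_expectation_Suc[OF n_ge_2]
      by (intro sum.cong refl) (simp only: step)
    also have "\<dots> = V N - (\<Sum>i\<in>{1..n}. guess_prob n a N i * (if i = 1 then 0 else 1))"
      by (simp add: V_def right_diff_distrib sum_subtractf)
    also have "(\<Sum>i\<in>{1..n}. guess_prob n a N i * (if i = 1 then 0 else 1)) = 1 - prob_correct n a N"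
      using n_ge_2 unfolding error_prob_eq[OF n_ge_2]
      by (simp add: sum_split_first)
    finally show ?thesis .
  qed
  have tele: "V K = V 0 - (\<Sum>N<K. 1 - prob_correct n a N)" for K
    by (induction K) (simp_all add: V_Suc)
  have V0: "V 0 \<le> S"
  proof -
    have "V 0 = (real n - 1) * S / real n"
      using sum_h by (simp add: V_def sum_divide_distrib[symmetric])
    also have "\<dots> \<le> S"
      using S0 n_ge_2 by (simp add: field_simps)
    finally show ?thesis .
  qed
  have "0 \<le> V (Suc N)"
    unfolding V_def by (intro sum_nonneg mult_nonneg_nonneg guess_prob_ge_0 h0)
  then have le: "(\<Sum>K<Suc N. 1 - prob_correct n a K) \<le> S"
    using tele[of "Suc N"] V0 by linarith
  \<comment> \<open>The error probability is decreasing in time, so \<open>Suc N\<close> copies of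
    its value at \<open>N\<close> stay below the partial sum.\<close>
  have "real (Suc N) * (1 - prob_correct n a N) = (\<Sum>K<Suc N. 1 - prob_correct n a N)"
    by simp
  also have "\<dots> \<le> (\<Sum>K<Suc N. 1 - prob_correct n a K)"
    by (intro sum_mono error_prob_antimono) simp
  also have "\<dots> \<le> S" by (rule le)
  finally show ?thesis
    by (simp add: S_def[symmetric] field_simps)
qed

text \<open>\<open>LEAST\<close> says nothing unless a witness exists. The witness is the floor of
  \<open>S / \<Delta>\<close>, where the denominator \<open>Suc N\<close> of the error bound exceeds
  \<open>S / \<Delta>\<close>.\<close>

lemma learning_time_less:
  assumes \<Delta>: "0 < \<Delta>" and lt1: "\<And>i. i \<in> {2..n} \<Longrightarrow> a i < 1"
  shows "1 - prob_correct n a (learning_time n a \<Delta>) \<le> \<Delta>"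
    and "real (learning_time n a \<Delta>) < (\<Sum>i\<in>{2..n}. 1 / (1 - a i)) / \<Delta> + 1"
proof -
  define S where "S = (\<Sum>i\<in>{2..n}. 1 / (1 - a i))"
  define N where "N = nat \<lfloor>S / \<Delta>\<rfloor>"
  have S0: "0 \<le> S"
    unfolding S_def using lt1 by (intro sum_nonneg) (simp add: less_imp_le)
  have N: "S / \<Delta> < real (Suc N)" "real N \<le> S / \<Delta>"
    using S0 \<Delta> by (simp_all add: N_def) linarith+
  have "S / real (Suc N) \<le> \<Delta>"
    using N(1) \<Delta> by (simp add: field_simps)
  then have ok: "1 - prob_correct n a N \<le> \<Delta>"
    using error_prob_le[of N, OF lt1] unfolding S_def[symmetric] by linarith
  show "1 - prob_correct n a (learning_time n a \<Delta>) \<le> \<Delta>"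
    unfolding learning_time_def using ok by (rule LeastI)
  have "learning_time n a \<Delta> \<le> N"
    unfolding learning_time_def using ok by (rule Least_le)
  then show "real (learning_time n a \<Delta>) < (\<Sum>i\<in>{2..n}. 1 / (1 - a i)) / \<Delta> + 1"
    using N(2) unfolding S_def[symmetric] by linarith
qed

text \<open>The expectation of \<open>g\<close> starts at 1 or more, loses at most
  \<open>2 * \<mu>\<close> per step, and is at most \<open>1 + \<rho>\<close> times the error
  probability because \<open>g\<close> vanishes at concept 1. The cap \<open>\<rho>\<close> keeps
  \<open>g\<close> bounded where \<open>1 - a i\<close> is tiny.\<close>

lemma error_prob_ge:
  assumes \<mu>: "0 < \<mu>" and \<rho>: "0 < \<rho>"
    and sum_ge: "(\<Sum>i\<in>{2..n}. min (\<mu> / (1 - a i)) \<rho>) \<ge> 1"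
  shows "1 - 2 * \<mu> * real N \<le> (1 + \<rho>) * (1 - prob_correct n a N)"
proof -
  define g where "g = (\<lambda>i. if i = 1 then 0 else 1 + min (\<mu> / (1 - a i)) \<rho>)"
  define V where "V = (\<lambda>N. \<Sum>j\<in>{1..n}. guess_prob n a N j * g j)"
  have sum_g: "(\<Sum>j\<in>{1..n}. g j) \<ge> real n"
  proof -
    have "(\<Sum>j\<in>{1..n}. g j) = (\<Sum>j\<in>{2..n}. 1 + min (\<mu> / (1 - a j)) \<rho>)"
      using n_ge_2 by (simp add: sum_split_first g_def)
    also have "\<dots> = (real n - 1) + (\<Sum>i\<in>{2..n}. min (\<mu> / (1 - a i)) \<rho>)"
      using n_ge_2 by (simp add: sum.distrib of_nat_diff)
    finally show ?thesis
      using sum_ge by linarith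
  qed
  have step: "g i + (1 - a i) * ((\<Sum>j\<in>{1..n}. g j) - real n * g i) / (real n - 1) \<ge> g i - 2 * \<mu>"
    if i: "i \<in> {1..n}" for i
  proof (cases "i = 1")
    case True
    then show ?thesis using \<mu> first_eq by simp
  next
    case False
    define x where "x = 1 - a i"
    have x: "0 \<le> x"
      using overlap_bounds[OF i] by (simp add: x_def)
    have gi: "g i = 1 + min (\<mu> / x) \<rho>"
      using False by (simp add: g_def x_def)
    have xm: "x * min (\<mu> / x) \<rho> \<le> \<mu>"
    \<comment> \<open>An overlap equal to 1 is allowed here; division by zero then makes the minimum
      0.\<close>
    proof (cases "x = 0")
      case False
      then have "x * min (\<mu> / x) \<rho> \<le> x * (\<mu> / x)"
        using x by (intro mult_left_mono) auto
      then show ?thesis using False by simp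
    qed (use \<mu> in simp)
    have "x * (real n - real n * g i) \<le> x * ((\<Sum>j\<in>{1..n}. g j) - real n * g i)"
      using x sum_g by (intro mult_left_mono) auto
    moreover have "x * (real n - real n * g i) = - (real n * (x * min (\<mu> / x) \<rho>))"
      unfolding gi by (simp add: algebra_simps)
    moreover have "real n * (x * min (\<mu> / x) \<rho>) \<le> real n * \<mu>"
      using xm by (intro mult_left_mono) auto
    ultimately have "- (real n * \<mu>) \<le> x * ((\<Sum>j\<in>{1..n}. g j) - real n * g i)"
      by linarith
    \<comment> \<open>The inequality \<open>n \<le> 2 * (n - 1)\<close> for \<open>n \<ge> 2\<close>
      is the source of the factor 2.\<close>
    moreover have "real n * \<mu> \<le> 2 * \<mu> * (real n - 1)"
      using n_ge_2 \<mu> by (simp add: algebra_simps)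
    ultimately have "- 2 * \<mu> * (real n - 1) \<le> x * ((\<Sum>j\<in>{1..n}. g j) - real n * g i)"
      by linarith
    then have "- 2 * \<mu> \<le> x * ((\<Sum>j\<in>{1..n}. g j) - real n * g i) / (real n - 1)"
      using n_ge_2 by (simp add: field_simps)
    then show ?thesis
      by (simp add: x_def)
  qed
  have V_Suc: "V (Suc N) \<ge> V N - 2 * \<mu>" for N
  proof -
    have "V (Suc N) \<ge> (\<Sum>i\<in>{1..n}. guess_prob n a N i * (g i - 2 * \<mu>))"
      unfolding V_def guess_prob_expectation_Suc[OF n_ge_2]
      by (intro sum_mono mult_left_mono guess_prob_ge_0 step)
    also have "(\<Sum>i\<in>{1..n}. guess_prob n a N i * (g i - 2 * \<mu>))
        = V N - (\<Sum>i\<in>{1..n}. guess_prob n a N i) * (2 * \<mu>)"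
      by (simp add: V_def right_diff_distrib sum_subtractf sum_distrib_right)
    finally show ?thesis
      unfolding sum_guess_prob[OF n_ge_2] by simp
  qed
  \<comment> \<open>The start is uniform, so the initial expectation is the average of
    \<open>g\<close>.\<close>
  have "V 0 \<ge> 1"
    using sum_g n_ge_2 by (simp add: V_def sum_divide_distrib[symmetric])
  then have "V N \<ge> 1 - 2 * \<mu> * real N"
  proof (induction N)
    case (Suc N)
    then show ?case using V_Suc[of N] by (simp add: algebra_simps)
  qed simp
  moreover have "V N \<le> (1 + \<rho>) * (1 - prob_correct n a N)"
  proof -
    have "V N = (\<Sum>i\<in>{2..n}. guess_prob n a N i * g i)"
      unfolding V_def using n_ge_2 by (simp add: sum_split_first g_def)
    also have "\<dots> \<le> (\<Sum>i\<in>{2..n}. guess_prob n a N i * (1 + \<rho>))"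
      by (intro sum_mono mult_left_mono guess_prob_ge_0) (auto simp: g_def)
    finally show ?thesis
      by (simp add: error_prob_eq[OF n_ge_2] sum_distrib_left mult.commute)
  qed
  ultimately show ?thesis
    by linarith
qed

text \<open>With \<open>\<rho> = (1 - \<Delta>) / 2\<close>, a learning time of at most
  \<open>\<rho> / (2 * \<mu>)\<close> would give \<open>1 - \<rho> \<le> (1 + \<rho>) * (1 - 2 *
  \<rho>) = 1 - \<rho> - 2 * \<rho>\<^sup>2\<close>, which is impossible.\<close>

lemma learning_time_greater:
  assumes \<Delta>: "0 < \<Delta>" "\<Delta> < 1" and \<mu>: "0 < \<mu>"
    and lt1: "\<And>i. i \<in> {2..n} \<Longrightarrow> a i < 1"
    and sum_ge: "(\<Sum>i\<in>{2..n}. min (\<mu> / (1 - a i)) ((1 - \<Delta>) / 2)) \<ge> 1"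
  shows "(1 - \<Delta>) / (4 * \<mu>) < real (learning_time n a \<Delta>)"
proof (rule ccontr)
  define \<rho> where "\<rho> = (1 - \<Delta>) / 2"
  have \<rho>: "0 < \<rho>" "\<Delta> = 1 - 2 * \<rho>"
    using \<Delta> by (simp_all add: \<rho>_def field_simps)
  let ?N = "learning_time n a \<Delta>"
  assume "\<not> ?thesis"
  then have "2 * \<mu> * real ?N \<le> \<rho>"
    using \<mu> by (simp add: \<rho>_def field_simps)
  moreover have "1 - 2 * \<mu> * real ?N \<le> (1 + \<rho>) * (1 - prob_correct n a ?N)"
    using error_prob_ge[OF \<mu> \<rho>(1)] sum_ge unfolding \<rho>_def by blast
  moreover have "(1 + \<rho>) * (1 - prob_correct n a ?N) \<le> (1 + \<rho>) * \<Delta>"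
    using learning_time_less(1)[OF \<Delta>(1) lt1] \<rho>(1) by (intro mult_left_mono) auto
  ultimately have "1 - \<rho> \<le> (1 + \<rho>) * \<Delta>"
    by linarith
  then have "1 - \<rho> \<le> (1 + \<rho>) * (1 - 2 * \<rho>)"
    using \<rho>(2) by simp
  then have "2 * \<rho> * \<rho> \<le> 0"
    by (simp add: algebra_simps)
  then show False
    using \<rho>(1) by (simp add: mult_le_0_iff)
qed

end

section \<open>Sums of independent bounded variables\<close>

text \<open>Independence removes the cross terms, and \<open>Z\<^sup>2 \<le> B * Z\<close> on
  \<open>[0, B]\<close> bounds each variance by \<open>B * m\<close> rather than
  \<open>B\<^sup>2\<close>. This gain matters for \<beta> = 0, where \<open>B\<close> is
  \<open>n * sqrt (ln n)\<close> while \<open>m\<close> is only of order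
  \<open>ln n\<close>.\<close>

lemma (in prob_space) variance_indep_sum_le:
  fixes Z :: "'i \<Rightarrow> 'a \<Rightarrow> real"
  assumes "finite I" and indep: "indep_vars (\<lambda>_. borel) Z I"
    and range: "\<And>i \<omega>. i \<in> I \<Longrightarrow> \<omega> \<in> space M \<Longrightarrow> Z i \<omega> \<in> {0..B}"
    and mean: "\<And>i. i \<in> I \<Longrightarrow> expectation (Z i) = m"
  shows "expectation (\<lambda>\<omega>. (\<Sum>i\<in>I. Z i \<omega> - m)\<^sup>2) \<le> real (card I) * (B * m)"
  using assms
proof (induction I rule: finite_induct)
  case (insert i I)
  have rv: "random_variable borel (Z j)" if "j \<in> insert i I" for j
    using insert.prems(1) that by (auto simp: indep_vars_def)
  note [measurable] = rv
  have bound: "\<bar>Z j \<omega> - m\<bar> \<le> B + \<bar>m\<bar>" if "j \<in> insert i I" "\<omega> \<in> space M" for j \<omega>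
    using insert.prems(2)[OF that] by auto
  define W where "W = (\<lambda>j \<omega>. Z j \<omega> - m)"
  define T where "T = (\<lambda>\<omega>. \<Sum>j\<in>I. W j \<omega>)"
  have [measurable]: "random_variable borel (W i)" "random_variable borel T"
    unfolding W_def T_def using rv by measurable
  have T_bound: "\<bar>T \<omega>\<bar> \<le> real (card I) * (B + \<bar>m\<bar>)" if "\<omega> \<in> space M" for \<omega>
  proof -
    have "\<bar>T \<omega>\<bar> \<le> (\<Sum>j\<in>I. \<bar>W j \<omega>\<bar>)"
      unfolding T_def by (rule sum_abs)
    also have "\<dots> \<le> (\<Sum>j\<in>I. B + \<bar>m\<bar>)"
      by (intro sum_mono) (use bound that in \<open>auto simp: W_def\<close>)
    finally show ?thesis by simp
  qed
  have int_W: "integrable M (W i)"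
    by (rule integrable_const_bound[where B="B + \<bar>m\<bar>"]) (use bound in \<open>auto simp: W_def\<close>)
  have int_T: "integrable M T"
    by (rule integrable_const_bound[where B="real (card I) * (B + \<bar>m\<bar>)"]) (use T_bound in auto)
  have int_Z: "integrable M (Z i)"
    by (rule integrable_const_bound[where B=B]) (use insert.prems(2)[of i] in auto)
  have int_Z2: "integrable M (\<lambda>\<omega>. (Z i \<omega>)\<^sup>2)"
    by (rule integrable_const_bound[where B="B\<^sup>2"])
       (use insert.prems(2)[of i] in \<open>auto intro!: power_mono\<close>)
  have int_W2: "integrable M (\<lambda>\<omega>. (W i \<omega>)\<^sup>2)"
    by (rule integrable_const_bound[where B="(B + \<bar>m\<bar>)\<^sup>2"])
       (use bound[of i] in \<open>auto simp: W_def abs_le_square_iff[symmetric]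
          intro!: AE_I2 order_trans[OF _ abs_ge_self]\<close>)
  have int_T2: "integrable M (\<lambda>\<omega>. (T \<omega>)\<^sup>2)"
    by (rule integrable_const_bound[where B="(real (card I) * (B + \<bar>m\<bar>))\<^sup>2"])
       (use T_bound in \<open>auto simp: abs_le_square_iff[symmetric]
          intro!: AE_I2 order_trans[OF _ abs_ge_self]\<close>)
  have "indep_vars (\<lambda>_. borel) W (insert i I)"
    unfolding W_def by (rule indep_vars_compose2[OF insert.prems(1)]) simp
  then have ind: "indep_var borel (W i) borel T"
    unfolding T_def using insert.hyps by (intro indep_vars_sum)
  have "expectation (W i) = 0"
    using insert.prems(3)[of i] int_Z by (simp add: W_def prob_space)
  then have cross: "expectation (\<lambda>\<omega>. W i \<omega> * T \<omega>) = 0"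
    by (simp add: indep_var_lebesgue_integral[OF ind int_W int_T])
  have int_WT: "integrable M (\<lambda>\<omega>. W i \<omega> * T \<omega>)"
    by (rule indep_var_integrable[OF ind int_W int_T])
  have var_W: "expectation (\<lambda>\<omega>. (W i \<omega>)\<^sup>2) \<le> B * m"
  proof -
    have "expectation (\<lambda>\<omega>. (W i \<omega>)\<^sup>2) = expectation (\<lambda>\<omega>. (Z i \<omega>)\<^sup>2) - m\<^sup>2"
      using variance_eq[OF int_Z int_Z2] insert.prems(3)[of i] by (simp add: W_def)
    also have "\<dots> \<le> expectation (\<lambda>\<omega>. (Z i \<omega>)\<^sup>2)"
      by simp
    also have "\<dots> \<le> expectation (\<lambda>\<omega>. B * Z i \<omega>)"
      using insert.prems(2)[of i] int_Z int_Z2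
      by (intro integral_mono) (auto simp: power2_eq_square mult_right_mono)
    also have "\<dots> = B * m"
      using insert.prems(3)[of i] by simp
    finally show ?thesis .
  qed
  have "(\<Sum>j\<in>insert i I. Z j \<omega> - m) = W i \<omega> + T \<omega>" for \<omega>
    using insert.hyps by (simp add: W_def T_def)
  then have "expectation (\<lambda>\<omega>. (\<Sum>j\<in>insert i I. Z j \<omega> - m)\<^sup>2)
      = expectation (\<lambda>\<omega>. (W i \<omega>)\<^sup>2 + (T \<omega>)\<^sup>2 + 2 * (W i \<omega> * T \<omega>))"
    by (simp only: power2_sum mult.assoc)
  also have "\<dots> = expectation (\<lambda>\<omega>. (W i \<omega>)\<^sup>2) + expectation (\<lambda>\<omega>. (T \<omega>)\<^sup>2)"
    using int_W2 int_T2 int_WT cross by simp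
  also have "\<dots> \<le> B * m + real (card I) * (B * m)"
    using var_W insert.IH[OF indep_vars_subset[OF insert.prems(1)]] insert.prems(2,3)
    by (intro add_mono) (auto simp: T_def W_def)
  finally show ?case
    using insert.hyps by (simp add: algebra_simps)
qed simp

lemma (in prob_space) Chebyshev_indep_sum:
  fixes Z :: "'i \<Rightarrow> 'a \<Rightarrow> real"
  assumes fin: "finite I" and indep: "indep_vars (\<lambda>_. borel) Z I"
    and range: "\<And>i \<omega>. i \<in> I \<Longrightarrow> \<omega> \<in> space M \<Longrightarrow> Z i \<omega> \<in> {0..B}"
    and mean: "\<And>i. i \<in> I \<Longrightarrow> expectation (Z i) = m"
    and t: "0 < t"
  shows "prob {\<omega> \<in> space M. t \<le> \<bar>(\<Sum>i\<in>I. Z i \<omega>) - real (card I) * m\<bar>}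
           \<le> real (card I) * (B * m) / t\<^sup>2"
proof -
  have [measurable]: "random_variable borel (Z j)" if "j \<in> I" for j
    using indep that by (auto simp: indep_vars_def)
  have int: "integrable M (\<lambda>\<omega>. (\<Sum>i\<in>I. Z i \<omega> - m)\<^sup>2)"
  proof (rule integrable_const_bound[where B="(real (card I) * (B + \<bar>m\<bar>))\<^sup>2"])
    show "AE \<omega> in M. norm ((\<Sum>i\<in>I. Z i \<omega> - m)\<^sup>2) \<le> (real (card I) * (B + \<bar>m\<bar>))\<^sup>2"
    proof (rule AE_I2)
      fix \<omega> assume \<omega>: "\<omega> \<in> space M"
      have "\<bar>\<Sum>i\<in>I. Z i \<omega> - m\<bar> \<le> (\<Sum>i\<in>I. \<bar>Z i \<omega> - m\<bar>)"
        by (rule sum_abs)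
      also have "\<dots> \<le> (\<Sum>i\<in>I. B + \<bar>m\<bar>)"
        using range[OF _ \<omega>] by (intro sum_mono) fastforce
      finally have "\<bar>\<Sum>i\<in>I. Z i \<omega> - m\<bar> \<le> real (card I) * (B + \<bar>m\<bar>)"
        by simp
      then show "norm ((\<Sum>i\<in>I. Z i \<omega> - m)\<^sup>2) \<le> (real (card I) * (B + \<bar>m\<bar>))\<^sup>2"
        by (simp add: abs_le_square_iff[symmetric])
    qed
  qed measurable
  have "{\<omega> \<in> space M. t \<le> \<bar>(\<Sum>i\<in>I. Z i \<omega>) - real (card I) * m\<bar>}
      = {\<omega> \<in> space M. t\<^sup>2 \<le> (\<Sum>i\<in>I. Z i \<omega> - m)\<^sup>2}"
    using t by (auto simp: sum_subtractf abs_le_square_iff[symmetric])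
  then have "prob {\<omega> \<in> space M. t \<le> \<bar>(\<Sum>i\<in>I. Z i \<omega>) - real (card I) * m\<bar>}
      \<le> expectation (\<lambda>\<omega>. (\<Sum>i\<in>I. Z i \<omega> - m)\<^sup>2) / t\<^sup>2"
    using integral_Markov_inequality_measure[OF int, of "{}" "t\<^sup>2"] t by simp
  also have "\<dots> \<le> real (card I) * (B * m) / t\<^sup>2"
    using variance_indep_sum_le[OF fin indep range mean] by (intro divide_right_mono) auto
  finally show ?thesis .
qed

section \<open>Independent samples with a common law\<close>

locale iid_sample = prob_space M for M :: "'w measure" +
  fixes I :: "'i set" and X :: "'i \<Rightarrow> 'w \<Rightarrow> real" and D :: "real measure"
  assumes finite_index: "finite I"
    and indep: "indep_vars (\<lambda>_. borel) X I"
    and distr_eq: "i \<in> I \<Longrightarrow> distr M borel (X i) = D"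
begin

lemma random_variable_X: "i \<in> I \<Longrightarrow> random_variable borel (X i)"
  using indep by (auto simp: indep_vars_def)

lemma expectation_comp:
  fixes h :: "real \<Rightarrow> real"
  assumes "i \<in> I" "h \<in> borel_measurable borel"
  shows "expectation (\<lambda>\<omega>. h (X i \<omega>)) = (\<integral>x. h x \<partial>D)"
  using integral_distr[OF random_variable_X[OF assms(1)] assms(2)] distr_eq[OF assms(1)] by simp

lemma prob_ex_le:
  assumes "A \<in> sets borel"
  shows "prob {\<omega> \<in> space M. \<exists>i\<in>I. X i \<omega> \<in> A} \<le> real (card I) * measure D A"
proof -
  have "{\<omega> \<in> space M. \<exists>i\<in>I. X i \<omega> \<in> A} = (\<Union>i\<in>I. X i -` A \<inter> space M)"
    by auto
  also have "prob \<dots> \<le> (\<Sum>i\<in>I. prob (X i -` A \<inter> space M))"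
    using finite_index random_variable_X assms
    by (intro finite_measure_subadditive_finite) (auto intro: measurable_sets)
  also have "\<dots> = (\<Sum>i\<in>I. measure D A)"
  proof (intro sum.cong refl)
    fix i assume "i \<in> I"
    then show "prob (X i -` A \<inter> space M) = measure D A"
      using measure_distr[OF random_variable_X assms] distr_eq by metis
  qed
  finally show ?thesis by simp
qed

lemma prob_sum_deviation_le:
  assumes [measurable]: "h \<in> borel_measurable borel"
    and range: "\<And>x. h x \<in> {0..B}" and "0 < t"
  shows "prob {\<omega> \<in> space M. t \<le> \<bar>(\<Sum>i\<in>I. h (X i \<omega>)) - real (card I) * (\<integral>x. h x \<partial>D)\<bar>}
           \<le> real (card I) * (B * (\<integral>x. h x \<partial>D)) / t\<^sup>2"
  using assms finite_index expectation_comp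
  by (intro Chebyshev_indep_sum indep_vars_compose2[OF indep]) auto

text \<open>Markov's inequality for the sum; the bound \<open>B\<close> ensures integrability and
  does not enter the estimate. It controls the sum of reciprocals when \<beta> < 0.\<close>

lemma prob_sum_ge_le:
  assumes [measurable]: "h \<in> borel_measurable borel"
    and range: "\<And>x. h x \<in> {0..B}" and t: "0 < t"
  shows "prob {\<omega> \<in> space M. t \<le> (\<Sum>i\<in>I. h (X i \<omega>))} \<le> real (card I) * (\<integral>x. h x \<partial>D) / t"
proof -
  note [measurable] = random_variable_X
  have int: "integrable M (\<lambda>\<omega>. h (X i \<omega>))" if "i \<in> I" for i
    using that range by (intro integrable_const_bound[where B=B]) auto
  have "prob {\<omega> \<in> space M. t \<le> (\<Sum>i\<in>I. h (X i \<omega>))} \<le> expectation (\<lambda>\<omega>. \<Sum>i\<in>I. h (X i \<omega>)) / t"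
    using int range t by (intro integral_Markov_inequality_measure[where A="{}"])
      (auto intro!: sum_nonneg)
  also have "expectation (\<lambda>\<omega>. \<Sum>i\<in>I. h (X i \<omega>)) = real (card I) * (\<integral>x. h x \<partial>D)"
    using int by (simp add: expectation_comp)
  finally show ?thesis .
qed

end

section \<open>Densities of power type at the origin\<close>

text \<open>Values below \<open>b\<close> are dropped rather than capped: the function stays below
  \<open>1 / b\<close>, so its moments exist, and it agrees with \<open>1 / x\<close> at every
  sample point once none lies below \<open>b\<close>.\<close>

definition truncated_inverse :: "real \<Rightarrow> real \<Rightarrow> real" where
  "truncated_inverse b x = (if b \<le> x then 1 / x else 0)"

lemma truncated_inverse_measurable [measurable]: "truncated_inverse b \<in> borel_measurable borel"
  unfolding truncated_inverse_def by measurable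

lemma truncated_inverse_range: "0 < b \<Longrightarrow> truncated_inverse b x \<in> {0..1 / b}"
  by (auto simp: truncated_inverse_def frac_le)

lemma integral_truncated_inverse_nonneg:
  assumes "0 < b"
  shows "0 \<le> (\<integral>x. truncated_inverse b x \<partial>N)"
proof (rule Bochner_Integration.integral_nonneg)
  show "0 \<le> truncated_inverse b x" for x
    using truncated_inverse_range[OF assms, of x] by simp
qed

text \<open>\<open>D\<close> will be the law of the rejection probability \<open>1 - a i\<close>.
  The bounds hold almost everywhere because an equation between measures, as in the uniform case,
  fixes the density only up to a null set.\<close>

locale power_density =
  fixes f :: "real \<Rightarrow> real" and D :: "real measure" and \<beta> l u x\<^sub>0 :: real
  assumes f_measurable [measurable]: "f \<in> borel_measurable borel"
    and f_nonneg: "\<And>x. 0 \<le> f x"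
    and D_eq: "D = density lborel (\<lambda>x. ennreal (f x))"
    and D_prob: "prob_space D"
    and D_nonpos: "measure D {..0} = 0"
    and bounds: "AE x in lborel. 0 < x \<and> x < x\<^sub>0 \<longrightarrow> l * x powr \<beta> \<le> f x \<and> f x \<le> u * x powr \<beta>"
    and x\<^sub>0: "0 < x\<^sub>0" "x\<^sub>0 \<le> 1"
    and \<beta>: "- 1 < \<beta>"
begin

sublocale prob_space D by (rule D_prob)

lemma sets_D [measurable_cong]: "sets D = sets borel"
  by (simp add: D_eq)

lemma space_D [simp]: "space D = UNIV"
  by (simp add: D_eq)

text \<open>On the support of \<open>h\<close> the density lies between \<open>l\<close> and
  \<open>u\<close> times \<open>x powr \<beta>\<close>; integration reduces masses and moments near
  the origin to an explicit integral \<open>J\<close>.\<close>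

lemma integral_bounds:
  assumes [measurable]: "h \<in> borel_measurable borel"
    and range: "\<And>x. h x \<in> {0..B}"
    and supp: "\<And>x. h x \<noteq> 0 \<Longrightarrow> 0 < x \<and> x < x\<^sub>0"
    and J: "has_bochner_integral lborel (\<lambda>x. h x * x powr \<beta>) J"
  shows "l * J \<le> (\<integral>x. h x \<partial>D)" "(\<integral>x. h x \<partial>D) \<le> u * J"
proof -
  have "integrable D h"
    using range by (intro integrable_const_bound[where B=B]) auto
  then have int: "integrable lborel (\<lambda>x. f x * h x)"
    unfolding D_eq using f_nonneg by (subst (asm) integrable_real_density) auto
  have eq: "(\<integral>x. h x \<partial>D) = (\<integral>x. f x * h x \<partial>lborel)"
    unfolding D_eq using f_nonneg by (subst integral_real_density) auto
  have J_int: "integrable lborel (\<lambda>x. h x * x powr \<beta>)" "(\<integral>x. h x * x powr \<beta> \<partial>lborel) = J"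
    using J by (auto simp: has_bochner_integral_iff)
  have "AE x in lborel. l * (h x * x powr \<beta>) \<le> f x * h x"
    using bounds
  proof eventually_elim
    case (elim x)
    show ?case
    proof (cases "h x = 0")
      case False
      then show ?thesis
        using elim supp[of x] range[of x] mult_right_mono[of "l * x powr \<beta>" "f x" "h x"]
        by (simp add: mult_ac)
    qed simp
  qed
  then have "(\<integral>x. l * (h x * x powr \<beta>) \<partial>lborel) \<le> (\<integral>x. f x * h x \<partial>lborel)"
    by (intro integral_mono_AE int integrable_mult_right J_int)
  then show "l * J \<le> (\<integral>x. h x \<partial>D)"
    by (simp add: eq J_int)
  have "AE x in lborel. f x * h x \<le> u * (h x * x powr \<beta>)"
    using bounds
  proof eventually_elim
    case (elim x)
    show ?case
    proof (cases "h x = 0")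
      case False
      then show ?thesis
        using elim supp[of x] range[of x] mult_right_mono[of "f x" "u * x powr \<beta>" "h x"]
        by (simp add: mult_ac)
    qed simp
  qed
  then have "(\<integral>x. f x * h x \<partial>lborel) \<le> (\<integral>x. u * (h x * x powr \<beta>) \<partial>lborel)"
    by (intro integral_mono_AE int integrable_mult_right J_int)
  then show "(\<integral>x. h x \<partial>D) \<le> u * J"
    by (simp add: eq J_int)
qed

lemma measure_lessThan_bounds:
  assumes "0 < b" "b \<le> x\<^sub>0"
  shows "l * (b powr (\<beta> + 1) / (\<beta> + 1)) \<le> measure D {..<b}"
    and "measure D {..<b} \<le> u * (b powr (\<beta> + 1) / (\<beta> + 1))"
proof -
  let ?J = "b powr (\<beta> + 1) / (\<beta> + 1)"
  have null: "emeasure D {..0} = 0"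
    using D_nonpos by (simp add: emeasure_eq_measure)
  have "measure D {..<b} = measure D {0<..<b}"
    using null AE_not_in[of "{..0}" D] by (intro measure_eq_AE) (auto simp: null_sets_def)
  then have eq: "measure D {..<b} = (\<integral>x. indicator {0<..<b} x \<partial>D)"
    by simp
  \<comment> \<open>For \<beta> < 0 the integrand is unbounded at 0. The value is computed as a
    gauge integral and carried over to Lebesgue measure by nonnegativity.\<close>
  have "((\<lambda>x. x powr \<beta>) has_integral ?J) {0..b}"
    using \<beta> assms by (intro has_integral_powr_from_0) auto
  then have "((\<lambda>x. x powr \<beta>) has_integral ?J) {0<..<b}"
    by (rule has_integral_Icc_iff_Ioo[THEN iffD1])
  then have "((\<lambda>x. indicator {0<..<b} x * x powr \<beta>) has_integral ?J) UNIV"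
    by (subst (asm) has_integral_restrict_UNIV[symmetric])
       (erule has_integral_eq[rotated], simp split: split_indicator)
  then have J: "has_bochner_integral lborel (\<lambda>x. indicator {0<..<b} x * x powr \<beta>) ?J"
    using \<beta> by (intro has_bochner_integral_nn_integral nn_integral_has_integral_lborel) auto
  have range: "indicator {0<..<b} x \<in> {0..1::real}" for x
    by (simp split: split_indicator)
  have supp: "0 < x \<and> x < x\<^sub>0" if "indicator {0<..<b} x \<noteq> (0::real)" for x
    using that assms by (simp split: split_indicator_asm)
  have "(indicator {0<..<b} :: real \<Rightarrow> real) \<in> borel_measurable borel"
    by simp
  note bnds = integral_bounds[OF this range supp J]
  show "l * ?J \<le> measure D {..<b}"
    using bnds(1) unfolding eq by assumption
  show "measure D {..<b} \<le> u * ?J"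
    using bnds(2) unfolding eq by assumption
qed

text \<open>The antiderivative \<open>G\<close> is a parameter, so that one proof serves
  \<open>ln\<close> for \<beta> = 0 and \<open>x powr \<beta> / \<beta>\<close> otherwise. From
  \<open>x\<^sub>0\<close> on the density is not controlled, but there \<open>1 / x\<close> is at
  most \<open>1 / x\<^sub>0\<close> and the total mass is 1.\<close>

lemma integral_truncated_inverse_bounds:
  assumes b: "0 < b" "b < x\<^sub>0"
    and G: "\<And>x. 0 < x \<Longrightarrow> (G has_real_derivative x powr (\<beta> - 1)) (at x)"
  shows "l * (G x\<^sub>0 - G b) \<le> (\<integral>x. truncated_inverse b x \<partial>D)"
    and "(\<integral>x. truncated_inverse b x \<partial>D) \<le> 1 / x\<^sub>0 + u * (G x\<^sub>0 - G b)"
proof -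
  let ?h = "\<lambda>x. indicator {b..<x\<^sub>0} x / x"
  have [measurable]: "?h \<in> borel_measurable borel"
    by measurable
  have range: "?h x \<in> {0..1 / b}" for x
    using b by (auto split: split_indicator simp: frac_le)
  have J: "has_bochner_integral lborel (\<lambda>x. x powr (\<beta> - 1) * indicator {b..x\<^sub>0} x) (G x\<^sub>0 - G b)"
    using b by (intro has_bochner_integral_FTC_Icc_nonneg DERIV_subset[OF G])
      (auto intro!: has_field_derivative_at_within G continuous_intros)
  \<comment> \<open>The fundamental theorem works on a closed interval, whereas
    \<open>integral_bounds\<close> wants the support below \<open>x\<^sub>0\<close>; the two
    integrands differ only at that point.\<close>
  have "AE x in lborel. x powr (\<beta> - 1) * indicator {b..x\<^sub>0} x = ?h x * x powr \<beta>"
    using AE_lborel_singleton[of x\<^sub>0]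
  proof eventually_elim
    case (elim x)
    then show ?case
      using b by (auto split: split_indicator simp: powr_diff)
  qed
  then have J': "has_bochner_integral lborel (\<lambda>x. ?h x * x powr \<beta>) (G x\<^sub>0 - G b)"
    using J by (subst has_bochner_integral_cong_AE[symmetric]) auto
  have supp: "0 < x \<and> x < x\<^sub>0" if "?h x \<noteq> 0" for x
    using that b by (auto split: split_indicator_asm)
  note bnds = integral_bounds[OF _ range supp J']
  have norm_h: "norm (?h x) \<le> 1 / b" for x
    using range[of x] by (metis abs_of_nonneg atLeastAtMost_iff real_norm_def)
  have int_h: "integrable D ?h"
    using norm_h by (intro integrable_const_bound[where B="1 / b"] AE_I2) auto
  have int_t: "integrable D (truncated_inverse b)"
    using truncated_inverse_range[OF b(1)] by (intro integrable_const_bound[where B="1 / b"]) auto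
  have "(\<integral>x. ?h x \<partial>D) \<le> (\<integral>x. truncated_inverse b x \<partial>D)"
    using b by (intro integral_mono int_h int_t)
      (auto simp: truncated_inverse_def split: split_indicator)
  then show "l * (G x\<^sub>0 - G b) \<le> (\<integral>x. truncated_inverse b x \<partial>D)"
    using bnds(1) by simp
  have "(\<integral>x. truncated_inverse b x \<partial>D) \<le> (\<integral>x. 1 / x\<^sub>0 + ?h x \<partial>D)"
    using b x\<^sub>0 by (intro integral_mono int_t Bochner_Integration.integrable_add int_h)
      (auto simp: truncated_inverse_def frac_le split: split_indicator)
  also have "\<dots> = 1 / x\<^sub>0 + (\<integral>x. ?h x \<partial>D)"
    using int_h prob_space by simp
  finally show "(\<integral>x. truncated_inverse b x \<partial>D) \<le> 1 / x\<^sub>0 + u * (G x\<^sub>0 - G b)"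
    using bnds(2) by simp
qed

end

section \<open>The learning time for random overlaps\<close>

text \<open>The scale \<open>s\<close> will be \<open>n * ln n\<close>, \<open>n\<close> or
  \<open>n powr (1 / (1 + \<beta>))\<close>, according to the sign of \<beta>.\<close>

definition rescaled_time_event ::
    "'w measure \<Rightarrow> nat \<Rightarrow> (nat \<Rightarrow> 'w \<Rightarrow> real) \<Rightarrow> real \<Rightarrow> real \<Rightarrow> real \<Rightarrow> real \<Rightarrow> 'w set" where
  "rescaled_time_event M n a \<Delta> s C\<^sub>1 C\<^sub>2 = {\<omega> \<in> space M.
     C\<^sub>1 < real (learning_time n (\<lambda>i. a i \<omega>) \<Delta>) / (\<bar>ln \<Delta>\<bar> * s) \<and>
     real (learning_time n (\<lambda>i. a i \<omega>) \<Delta>) / (\<bar>ln \<Delta>\<bar> * s) < C\<^sub>2}"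

locale random_learner = prob_space M for M :: "'w measure" +
  fixes n :: nat and a :: "nat \<Rightarrow> 'w \<Rightarrow> real" and D :: "real measure" and \<Delta> :: real
  assumes n_ge_2: "n \<ge> 2"
    and first_eq: "\<omega> \<in> space M \<Longrightarrow> a 1 \<omega> = 1"
    and overlap_range: "i \<in> {2..n} \<Longrightarrow> \<omega> \<in> space M \<Longrightarrow> a i \<omega> \<in> {0..1}"
    and overlap_indep: "indep_vars (\<lambda>_. borel) a {2..n}"
    and rejection_distr: "i \<in> {2..n} \<Longrightarrow> distr M borel (\<lambda>\<omega>. 1 - a i \<omega>) = D"
    and \<Delta>: "0 < \<Delta>" "\<Delta> < 1"
begin

sublocale iid_sample M "{2..n}" "\<lambda>i \<omega>. 1 - a i \<omega>" D
proof
  show "indep_vars (\<lambda>_. borel) (\<lambda>i \<omega>. 1 - a i \<omega>) {2..n}"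
    by (rule indep_vars_compose2[OF overlap_indep]) simp
qed (use rejection_distr in auto)

lemma card_concepts: "real (card {2..n}) = real n - 1"
  using n_ge_2 by (simp add: of_nat_diff)

lemma learner: "\<omega> \<in> space M \<Longrightarrow> memoryless_learner n (\<lambda>i. a i \<omega>)"
  using n_ge_2 first_eq overlap_range by unfold_locales auto

lemma overlap_measurable: "i \<in> {1..n} \<Longrightarrow> random_variable borel (a i)"
proof (cases "i = 1")
  case True
  then show ?thesis
    using first_eq by (subst measurable_cong[where g="\<lambda>_. 1"]) auto
next
  case False
  then show "i \<in> {1..n} \<Longrightarrow> ?thesis"
    using overlap_indep by (auto simp: indep_vars_def)
qed

lemma guess_prob_measurable: "random_variable borel (\<lambda>\<omega>. guess_prob n (\<lambda>i. a i \<omega>) N j)"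
proof (induction N arbitrary: j)
  case (Suc N)
  note [measurable] = Suc.IH overlap_measurable
  show ?case
    unfolding guess_prob.simps
    by (intro borel_measurable_sum borel_measurable_times Suc.IH) auto
qed simp

lemma learning_time_measurable [measurable]:
  "(\<lambda>\<omega>. learning_time n (\<lambda>i. a i \<omega>) \<Delta>) \<in> measurable M (count_space UNIV)"
proof -
  note [measurable] = guess_prob_measurable
  show ?thesis
    using n_ge_2 unfolding learning_time_def by (simp add: prob_correct_eq)
qed

lemma rescaled_time_event_measurable: "rescaled_time_event M n a \<Delta> s C\<^sub>1 C\<^sub>2 \<in> events"
  unfolding rescaled_time_event_def by measurable

text \<open>Off \<open>Bad\<close> the deterministic bounds apply pointwise: the lower one with
  \<open>\<mu> = A / s\<close>, the upper one with a sum of reciprocals of at most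
  \<open>C * s\<close>, where \<open>1 \<le> s\<close> absorbs the additive 1. Each regime of
  \<beta> only has to supply \<open>Bad\<close> and the constants.\<close>

lemma prob_learning_time_bounds:
  assumes s: "1 \<le> s" and A: "0 < A" and C: "0 < C"
    and Bad: "Bad \<in> events"
    and good: "\<And>\<omega>. \<omega> \<in> space M \<Longrightarrow> \<omega> \<notin> Bad \<Longrightarrow>
      (\<forall>i\<in>{2..n}. a i \<omega> < 1) \<and> (\<Sum>i\<in>{2..n}. 1 / (1 - a i \<omega>)) \<le> C * s \<and>
      1 \<le> (\<Sum>i\<in>{2..n}. min (A / s / (1 - a i \<omega>)) ((1 - \<Delta>) / 2))"
  shows "1 - prob Bad \<le> prob (rescaled_time_event M n a \<Delta> s
      ((1 - \<Delta>) / (4 * A * \<bar>ln \<Delta>\<bar>)) ((C / \<Delta> + 1) / \<bar>ln \<Delta>\<bar>))"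
proof -
  have L: "0 < \<bar>ln \<Delta>\<bar>"
    using \<Delta> by simp
  have "space M - Bad \<subseteq> (rescaled_time_event M n a \<Delta> s
      ((1 - \<Delta>) / (4 * A * \<bar>ln \<Delta>\<bar>)) ((C / \<Delta> + 1) / \<bar>ln \<Delta>\<bar>))"
    unfolding rescaled_time_event_def
  proof (intro subsetI CollectI conjI; (elim DiffE)?)
    fix \<omega> assume \<omega>: "\<omega> \<in> space M" "\<omega> \<notin> Bad"
    interpret memoryless_learner n "\<lambda>i. a i \<omega>"
      by (rule learner[OF \<omega>(1)])
    let ?N = "real (learning_time n (\<lambda>i. a i \<omega>) \<Delta>)"
    have lt1: "a i \<omega> < 1" if "i \<in> {2..n}" for i
      using good[OF \<omega>] that by blast
    have "(1 - \<Delta>) / (4 * (A / s)) < ?N"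
      using good[OF \<omega>] \<Delta> A s by (intro learning_time_greater lt1) auto
    then have "(1 - \<Delta>) / (4 * (A / s)) / (\<bar>ln \<Delta>\<bar> * s) < ?N / (\<bar>ln \<Delta>\<bar> * s)"
      using L s by (intro divide_strict_right_mono) auto
    moreover have "(1 - \<Delta>) / (4 * (A / s)) / (\<bar>ln \<Delta>\<bar> * s) = (1 - \<Delta>) / (4 * A * \<bar>ln \<Delta>\<bar>)"
      using L s A by (simp add: field_simps)
    ultimately show "(1 - \<Delta>) / (4 * A * \<bar>ln \<Delta>\<bar>) < ?N / (\<bar>ln \<Delta>\<bar> * s)"
      by simp
    have "?N < (\<Sum>i\<in>{2..n}. 1 / (1 - a i \<omega>)) / \<Delta> + 1"
      by (rule learning_time_less(2)[OF \<Delta>(1) lt1])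
    also have "\<dots> \<le> C * s / \<Delta> + s"
      using good[OF \<omega>] \<Delta> s by (intro add_mono divide_right_mono) auto
    finally have "?N / (\<bar>ln \<Delta>\<bar> * s) < (C * s / \<Delta> + s) / (\<bar>ln \<Delta>\<bar> * s)"
      using L s by (intro divide_strict_right_mono) auto
    also have "(C * s / \<Delta> + s) / (\<bar>ln \<Delta>\<bar> * s) = (C / \<Delta> + 1) / \<bar>ln \<Delta>\<bar>"
      using L s \<Delta> by (simp add: field_simps)
    finally show "?N / (\<bar>ln \<Delta>\<bar> * s) < (C / \<Delta> + 1) / \<bar>ln \<Delta>\<bar>" .
  qed auto
  then have "prob (space M - Bad) \<le> prob (rescaled_time_event M n a \<Delta> s
      ((1 - \<Delta>) / (4 * A * \<bar>ln \<Delta>\<bar>)) ((C / \<Delta> + 1) / \<bar>ln \<Delta>\<bar>))"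
    by (intro finite_measure_mono rescaled_time_event_measurable)
  then show ?thesis
    by (simp add: prob_compl[OF Bad])
qed

section \<open>Exceptional events in the three regimes\<close>

lemma sum_inverse_eq_truncated:
  assumes "0 < b" "\<And>i. i \<in> {2..n} \<Longrightarrow> b \<le> 1 - a i \<omega>"
  shows "(\<Sum>i\<in>{2..n}. 1 / (1 - a i \<omega>)) = (\<Sum>i\<in>{2..n}. truncated_inverse b (1 - a i \<omega>))"
  using assms by (intro sum.cong) (auto simp: truncated_inverse_def)

text \<open>Two exceptional events: off \<open>small b\<close> the truncation changes no summand,
  and off \<open>deviation b t\<close> the truncated sum is within \<open>t\<close> of its
  mean.\<close>

abbreviation small :: "real \<Rightarrow> 'w set" where
  "small b \<equiv> {\<omega> \<in> space M. \<exists>i\<in>{2..n}. 1 - a i \<omega> \<in> {..<b}}"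

abbreviation deviation :: "real \<Rightarrow> real \<Rightarrow> 'w set" where
  "deviation b t \<equiv> {\<omega> \<in> space M. t \<le> \<bar>(\<Sum>i\<in>{2..n}. truncated_inverse b (1 - a i \<omega>))
      - real (card {2..n}) * (\<integral>x. truncated_inverse b x \<partial>D)\<bar>}"

lemma small_event: "small b \<in> events"
proof -
  note [measurable] = random_variable_X
  show ?thesis by measurable
qed

lemma deviation_event: "deviation b t \<in> events"
proof -
  note [measurable] = random_variable_X
  show ?thesis by measurable
qed

text \<open>The union bound handles \<open>small b\<close>; Chebyshev's inequality with range
  \<open>1 / b\<close> handles \<open>deviation b t\<close>.\<close>

lemma prob_small_deviation_le:
  assumes b: "0 < b" and t: "0 < t"
    and d: "measure D {..<b} \<le> d"
    and U: "(\<integral>x. truncated_inverse b x \<partial>D) \<le> U"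
  shows "prob (small b \<union> deviation b t) \<le> real n * d + real n * U / (b * t\<^sup>2)"
proof -
  have d0: "0 \<le> d"
    using d measure_nonneg[of D] order_trans by blast
  have U0: "0 \<le> U"
    using U integral_truncated_inverse_nonneg[OF b, of D] by linarith
  have "prob (small b) \<le> (real n - 1) * measure D {..<b}"
    using prob_ex_le[of "{..<b}"] unfolding card_concepts by simp
  also have "\<dots> \<le> real n * d"
    using d d0 n_ge_2 by (intro mult_mono) auto
  finally have 1: "prob (small b) \<le> real n * d" .
  have "prob (deviation b t) \<le> (real n - 1) * (1 / b * (\<integral>x. truncated_inverse b x \<partial>D)) / t\<^sup>2"
    using prob_sum_deviation_le[OF truncated_inverse_measurable truncated_inverse_range[OF b] t]
    unfolding card_concepts .
  also have "\<dots> \<le> real n * (1 / b * U) / t\<^sup>2"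
    using U U0 b n_ge_2 integral_truncated_inverse_nonneg[OF b, of D]
    by (intro divide_right_mono mult_mono mult_left_mono) auto
  also have "\<dots> = real n * U / (b * t\<^sup>2)"
    by simp
  finally have 2: "prob (deviation b t) \<le> real n * U / (b * t\<^sup>2)" .
  show ?thesis
    using 1 2 measure_Un_le[OF small_event deviation_event, of b t b] by linarith
qed

lemma not_small_deviation:
  assumes b: "0 < b" and t: "0 < t" and n_t: "real n * U + t \<le> K"
    and U: "(\<integral>x. truncated_inverse b x \<partial>D) \<le> U"
    and \<omega>: "\<omega> \<in> space M" "\<omega> \<notin> small b \<union> deviation b t"
  shows "\<forall>i\<in>{2..n}. b \<le> 1 - a i \<omega>" "\<forall>i\<in>{2..n}. a i \<omega> < 1"
    and "(\<Sum>i\<in>{2..n}. 1 / (1 - a i \<omega>)) \<le> K"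
    and "(real n - 1) * (\<integral>x. truncated_inverse b x \<partial>D) - t
           \<le> (\<Sum>i\<in>{2..n}. truncated_inverse b (1 - a i \<omega>))"
proof -
  show ge: "\<forall>i\<in>{2..n}. b \<le> 1 - a i \<omega>"
    using \<omega> by (auto simp: not_less)
  then show "\<forall>i\<in>{2..n}. a i \<omega> < 1"
    using b by fastforce
  have U0: "0 \<le> U"
    using U integral_truncated_inverse_nonneg[OF b, of D] by linarith
  have dev: "\<bar>(\<Sum>i\<in>{2..n}. truncated_inverse b (1 - a i \<omega>))
      - (real n - 1) * (\<integral>x. truncated_inverse b x \<partial>D)\<bar> < t"
    using \<omega> by (auto simp: not_le card_concepts simp del: card_atLeastAtMost)
  have "(real n - 1) * (\<integral>x. truncated_inverse b x \<partial>D) \<le> (real n - 1) * U"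
    using U n_ge_2 by (intro mult_left_mono) auto
  also have "\<dots> \<le> real n * U"
    using U0 by (intro mult_right_mono) auto
  finally show "(\<Sum>i\<in>{2..n}. 1 / (1 - a i \<omega>)) \<le> K"
    using dev n_t ge sum_inverse_eq_truncated[OF b, of \<omega>] by auto
  show "(real n - 1) * (\<integral>x. truncated_inverse b x \<partial>D) - t
           \<le> (\<Sum>i\<in>{2..n}. truncated_inverse b (1 - a i \<omega>))"
    using dev by linarith
qed

text \<open>Serves \<beta> = 0. The assumption \<open>cutoff\<close> makes the cap
  \<open>(1 - \<Delta>) / 2\<close> inactive for values from \<open>b\<close> on, so the sum of
  minima is at least \<open>A / s\<close> times the truncated sum, hence at least 1 by
  \<open>lower\<close>.\<close>

lemma prob_learning_time_bounds_critical:
  assumes s: "1 \<le> s" and A: "0 < A" and C: "0 < C" and b: "0 < b" and t: "0 < t"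
    and d: "measure D {..<b} \<le> d"
    and U: "(\<integral>x. truncated_inverse b x \<partial>D) \<le> U"
    and L: "L \<le> (\<integral>x. truncated_inverse b x \<partial>D)"
    and upper: "real n * U + t \<le> C * s"
    and lower: "s / A \<le> (real n - 1) * L - t"
    and cutoff: "A / s / b \<le> (1 - \<Delta>) / 2"
  shows "1 - (real n * d + real n * U / (b * t\<^sup>2)) \<le> prob (rescaled_time_event M n a \<Delta> s
      ((1 - \<Delta>) / (4 * A * \<bar>ln \<Delta>\<bar>)) ((C / \<Delta> + 1) / \<bar>ln \<Delta>\<bar>))"
proof -
  let ?Bad = "small b \<union> deviation b t"
  have "1 - prob ?Bad \<le> prob (rescaled_time_event M n a \<Delta> s
      ((1 - \<Delta>) / (4 * A * \<bar>ln \<Delta>\<bar>)) ((C / \<Delta> + 1) / \<bar>ln \<Delta>\<bar>))"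
  proof (rule prob_learning_time_bounds[OF s A C])
    show "?Bad \<in> events"
      using small_event deviation_event by (rule sets.Un)
    fix \<omega> assume \<omega>: "\<omega> \<in> space M" "\<omega> \<notin> ?Bad"
    note good = not_small_deviation[OF b t upper U \<omega>]
    have "s / A \<le> (real n - 1) * (\<integral>x. truncated_inverse b x \<partial>D) - t"
    proof -
      have "(real n - 1) * L \<le> (real n - 1) * (\<integral>x. truncated_inverse b x \<partial>D)"
        using n_ge_2 by (intro mult_left_mono L) simp
      then show ?thesis
        using lower by linarith
    qed
    also have "\<dots> \<le> (\<Sum>i\<in>{2..n}. truncated_inverse b (1 - a i \<omega>))"
      by (rule good(4))
    finally have "1 \<le> A / s * (\<Sum>i\<in>{2..n}. truncated_inverse b (1 - a i \<omega>))"
      using A s by (simp add: field_simps)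
    also have "\<dots> \<le> (\<Sum>i\<in>{2..n}. min (A / s / (1 - a i \<omega>)) ((1 - \<Delta>) / 2))"
      unfolding sum_distrib_left
    proof (rule sum_mono)
      fix i assume "i \<in> {2..n}"
      then have i: "b \<le> 1 - a i \<omega>"
        using good(1) by blast
      then have "A / s / (1 - a i \<omega>) \<le> A / s / b"
        using A s b by (intro divide_left_mono) auto
      with cutoff have "A / s / (1 - a i \<omega>) \<le> (1 - \<Delta>) / 2"
        by linarith
      then show "A / s * truncated_inverse b (1 - a i \<omega>) \<le> min (A / s / (1 - a i \<omega>)) ((1 - \<Delta>) / 2)"
        using i by (simp add: truncated_inverse_def)
    qed
    finally show "(\<forall>i\<in>{2..n}. a i \<omega> < 1) \<and> (\<Sum>i\<in>{2..n}. 1 / (1 - a i \<omega>)) \<le> C * s \<and>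
      1 \<le> (\<Sum>i\<in>{2..n}. min (A / s / (1 - a i \<omega>)) ((1 - \<Delta>) / 2))"
      using good(2,3) by blast
  qed
  then show ?thesis
    using prob_small_deviation_le[OF b t d U] by linarith
qed

text \<open>Serves \<beta> > 0. As \<open>0 < 1 - a i \<le> 1\<close> on the good event, each
  minimum is at least \<open>2 / n\<close> once \<open>2 / n\<close> is below the cap, and the
  \<open>n - 1\<close> of them sum up to at least 1. So the lower bound holds with
  \<open>A = 2\<close>, and the deviation estimate is used only from above.\<close>

lemma prob_learning_time_bounds_light:
  assumes C: "0 < C" and b: "0 < b" and t: "0 < t"
    and d: "measure D {..<b} \<le> d"
    and U: "(\<integral>x. truncated_inverse b x \<partial>D) \<le> U"
    and upper: "real n * U + t \<le> C * real n"
    and cutoff: "2 / real n \<le> (1 - \<Delta>) / 2"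
  shows "1 - (real n * d + real n * U / (b * t\<^sup>2)) \<le> prob (rescaled_time_event M n a \<Delta> (real n)
      ((1 - \<Delta>) / (4 * 2 * \<bar>ln \<Delta>\<bar>)) ((C / \<Delta> + 1) / \<bar>ln \<Delta>\<bar>))"
proof -
  let ?Bad = "small b \<union> deviation b t"
  have "1 - prob ?Bad \<le> prob (rescaled_time_event M n a \<Delta> (real n)
      ((1 - \<Delta>) / (4 * 2 * \<bar>ln \<Delta>\<bar>)) ((C / \<Delta> + 1) / \<bar>ln \<Delta>\<bar>))"
  proof (rule prob_learning_time_bounds[OF _ _ C])
    show "?Bad \<in> events"
      using small_event deviation_event by (rule sets.Un)
    fix \<omega> assume \<omega>: "\<omega> \<in> space M" "\<omega> \<notin> ?Bad"
    note good = not_small_deviation[OF b t upper U \<omega>]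
    have "1 \<le> (real n - 1) * (2 / real n)"
      using n_ge_2 by (simp add: field_simps)
    also have "\<dots> = (\<Sum>i\<in>{2..n}. 2 / real n)"
      by (simp only: sum_constant card_concepts)
    also have "\<dots> \<le> (\<Sum>i\<in>{2..n}. min (2 / real n / (1 - a i \<omega>)) ((1 - \<Delta>) / 2))"
    proof (rule sum_mono)
      fix i assume i: "i \<in> {2..n}"
      then have "0 < 1 - a i \<omega>" "1 - a i \<omega> \<le> 1"
        using good(2) overlap_range[OF i \<omega>(1)] by auto
      then have "2 / real n / 1 \<le> 2 / real n / (1 - a i \<omega>)"
        by (intro divide_left_mono) auto
      then show "2 / real n \<le> min (2 / real n / (1 - a i \<omega>)) ((1 - \<Delta>) / 2)"
        using cutoff by simp
    qed
    finally show "(\<forall>i\<in>{2..n}. a i \<omega> < 1) \<and> (\<Sum>i\<in>{2..n}. 1 / (1 - a i \<omega>)) \<le> C * real n \<and>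
      1 \<le> (\<Sum>i\<in>{2..n}. min (2 / real n / (1 - a i \<omega>)) ((1 - \<Delta>) / 2))"
      using good(2,3) by blast
  qed (use n_ge_2 in auto)
  then show ?thesis
    using prob_small_deviation_le[OF b t d U] by linarith
qed

text \<open>Serves \<beta> < 0. Each value below \<open>h\<close> contributes the full cap
  \<open>(1 - \<Delta>) / 2\<close> to the sum of minima, so \<open>2 / (1 - \<Delta>)\<close> of
  them suffice. Their mean number is at least twice that, and Chebyshev's inequality keeps the count
  above half its mean.\<close>

lemma prob_learning_time_bounds_heavy:
  assumes s: "1 \<le> s" and A: "0 < A" and C: "0 < C" and b: "0 < b"
    and d: "measure D {..<b} \<le> d"
    and U: "(\<integral>x. truncated_inverse b x \<partial>D) \<le> U"
    and h: "0 < h" "h * s \<le> A"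
    and q: "q \<le> measure D {..<h}" "4 / (1 - \<Delta>) \<le> (real n - 1) * q"
  shows "1 - (real n * d + real n * U / (C * s) + 4 / ((real n - 1) * q)) \<le> prob (rescaled_time_event M n a \<Delta> s
      ((1 - \<Delta>) / (4 * A * \<bar>ln \<Delta>\<bar>)) ((C / \<Delta> + 1) / \<bar>ln \<Delta>\<bar>))"
proof -
  note [measurable] = random_variable_X
  let ?k = "real n - 1" and ?p = "measure D {..<h}"
  let ?large = "{\<omega> \<in> space M. C * s \<le> (\<Sum>i\<in>{2..n}. truncated_inverse b (1 - a i \<omega>))}"
  let ?few = "{\<omega> \<in> space M. ?k * ?p / 2 \<le>
      \<bar>(\<Sum>i\<in>{2..n}. indicator {..<h} (1 - a i \<omega>)) - real (card {2..n}) * (\<integral>x. indicator {..<h} x \<partial>D)\<bar>}"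
  let ?Bad = "small b \<union> ?large \<union> ?few"
  have k: "1 \<le> ?k"
    using n_ge_2 by simp
  have sets_D: "sets D = sets borel"
    using rejection_distr[of 2] n_ge_2 by (metis atLeastAtMost_iff order_refl sets_distr)
  have q_le: "?k * q \<le> ?k * ?p"
    using q(1) k by (intro mult_left_mono) auto
  have "4 \<le> 4 / (1 - \<Delta>)"
    using \<Delta> by (simp add: field_simps)
  then have kq: "4 \<le> ?k * q"
    using q(2) by linarith
  have int_ind: "(\<integral>x. indicator {..<h} x \<partial>D) = ?p"
    using sets_D sets_eq_imp_space_eq[OF sets_D] by simp
  have d0: "0 \<le> d"
    using d measure_nonneg[of D] order_trans by blast
  have "prob (small b) \<le> ?k * measure D {..<b}"
    using prob_ex_le[of "{..<b}"] unfolding card_concepts by simp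
  also have "\<dots> \<le> real n * d"
    using d d0 k by (intro mult_mono) auto
  finally have 1: "prob (small b) \<le> real n * d" .
  have U0: "0 \<le> U"
    using U integral_truncated_inverse_nonneg[OF b, of D] by linarith
  have "prob ?large \<le> ?k * (\<integral>x. truncated_inverse b x \<partial>D) / (C * s)"
    using prob_sum_ge_le[OF truncated_inverse_measurable truncated_inverse_range[OF b], of "C * s"] s C
    unfolding card_concepts by auto
  also have "\<dots> \<le> real n * U / (C * s)"
    using U U0 s C k integral_truncated_inverse_nonneg[OF b, of D]
    by (intro divide_right_mono mult_mono) auto
  finally have 2: "prob ?large \<le> real n * U / (C * s)" .
  \<comment> \<open>Indicators have range bound 1, and the deviation is half the mean
    \<open>?k * ?p\<close>, which leaves \<open>4 / (?k * ?p)\<close>.\<close>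
  have "prob ?few \<le> real (card {2..n}) * (1 * (\<integral>x. indicator {..<h} x \<partial>D)) / (?k * ?p / 2)\<^sup>2"
    using kq q_le by (intro prob_sum_deviation_le) (auto split: split_indicator)
  also have "\<dots> = 4 / (?k * ?p)"
    unfolding int_ind card_concepts by (simp add: power2_eq_square)
  also have "\<dots> \<le> 4 / (?k * q)"
    using kq q_le by (intro divide_left_mono) auto
  finally have 3: "prob ?few \<le> 4 / (?k * q)" .
  have ev: "?large \<in> events" "?few \<in> events"
    by measurable
  have "1 - prob ?Bad \<le> prob (rescaled_time_event M n a \<Delta> s
      ((1 - \<Delta>) / (4 * A * \<bar>ln \<Delta>\<bar>)) ((C / \<Delta> + 1) / \<bar>ln \<Delta>\<bar>))"
  proof (rule prob_learning_time_bounds[OF s A C])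
    show "?Bad \<in> events"
      using small_event ev by (intro sets.Un)
    fix \<omega> assume \<omega>: "\<omega> \<in> space M" "\<omega> \<notin> ?Bad"
    have ge: "b \<le> 1 - a i \<omega>" if "i \<in> {2..n}" for i
      using \<omega> that by (auto simp: not_less)
    then have lt1: "a i \<omega> < 1" if "i \<in> {2..n}" for i
      using b that by fastforce
    have sum_le: "(\<Sum>i\<in>{2..n}. 1 / (1 - a i \<omega>)) \<le> C * s"
    proof -
      have "(\<Sum>i\<in>{2..n}. 1 / (1 - a i \<omega>)) = (\<Sum>i\<in>{2..n}. truncated_inverse b (1 - a i \<omega>))"
        by (rule sum_inverse_eq_truncated[OF b ge])
      moreover have "(\<Sum>i\<in>{2..n}. truncated_inverse b (1 - a i \<omega>)) < C * s"
        using \<omega> by (auto simp: not_le)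
      ultimately show ?thesis
        by simp
    qed
    have "?k * ?p / 2 < (\<Sum>i\<in>{2..n}. indicator {..<h} (1 - a i \<omega>))"
      using \<omega> unfolding int_ind card_concepts by (auto simp: not_le abs_if split: if_splits)
    then have "2 / (1 - \<Delta>) \<le> (\<Sum>i\<in>{2..n}. indicator {..<h} (1 - a i \<omega>))"
      using q(2) q_le by auto
    then have "1 \<le> (1 - \<Delta>) / 2 * (\<Sum>i\<in>{2..n}. indicator {..<h} (1 - a i \<omega>))"
      using \<Delta> by (simp add: field_simps)
    also have "\<dots> \<le> (\<Sum>i\<in>{2..n}. min (A / s / (1 - a i \<omega>)) ((1 - \<Delta>) / 2))"
      unfolding sum_distrib_left
    proof (rule sum_mono)
      fix i assume i: "i \<in> {2..n}"
      show "(1 - \<Delta>) / 2 * indicator {..<h} (1 - a i \<omega>) \<le> min (A / s / (1 - a i \<omega>)) ((1 - \<Delta>) / 2)"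
      proof (cases "1 - a i \<omega> < h")
        case True
        \<comment> \<open>Below \<open>h\<close> the first argument of the minimum is at least 1,
          because \<open>h * s \<le> A\<close>; so the cap is attained.\<close>
        have "(1 - \<Delta>) / 2 \<le> 1"
          using \<Delta> by simp
        also have "1 \<le> A / s / h"
          using h s by (simp add: pos_le_divide_eq mult.commute)
        also have "\<dots> \<le> A / s / (1 - a i \<omega>)"
          using True lt1[OF i] A s h by (intro divide_left_mono) auto
        finally show ?thesis
          using True by simp
      next
        case False
        then show ?thesis
          using lt1[OF i] A s \<Delta> by simp
      qed
    qed
    finally show "(\<forall>i\<in>{2..n}. a i \<omega> < 1) \<and> (\<Sum>i\<in>{2..n}. 1 / (1 - a i \<omega>)) \<le> C * s \<and>
      1 \<le> (\<Sum>i\<in>{2..n}. min (A / s / (1 - a i \<omega>)) ((1 - \<Delta>) / 2))"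
      using lt1 sum_le by blast
  qed
  moreover have "prob ?Bad \<le> prob (small b) + prob ?large + prob ?few"
    using measure_Un_le[OF sets.Un[OF small_event ev(1)] ev(2), of b]
      measure_Un_le[OF small_event ev(1), of b] by linarith
  ultimately show ?thesis
    using 1 2 3 by linarith
qed

end

section \<open>Asymptotics\<close>

text \<open>The error is \<open>K * x powr \<delta>\<close> times \<open>x powr \<beta>\<close>, and
  the first factor drops below \<open>c / 2\<close> near 0.\<close>

lemma powr_bounds_of_bigo:
  fixes f :: "real \<Rightarrow> real"
  assumes c: "0 < c" and \<delta>: "0 < \<delta>"
    and bigo: "(\<lambda>x. f x - c * x powr \<beta>) \<in> O[at_right 0](\<lambda>x. x powr (\<beta> + \<delta>))"
  obtains x\<^sub>0 where "0 < x\<^sub>0" "x\<^sub>0 \<le> 1"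
    "\<And>x. 0 < x \<Longrightarrow> x < x\<^sub>0 \<Longrightarrow> c / 2 * x powr \<beta> \<le> f x \<and> f x \<le> 2 * c * x powr \<beta>"
proof -
  obtain K where K: "0 < K"
      "\<forall>\<^sub>F x in at_right 0. norm (f x - c * x powr \<beta>) \<le> K * norm (x powr (\<beta> + \<delta>))"
    using bigo by (elim landau_o.bigE)
  have "((\<lambda>x. K * x powr \<delta>) \<longlongrightarrow> 0) (at_right 0)"
    using \<delta> by real_asymp
  then have "\<forall>\<^sub>F x in at_right 0. K * x powr \<delta> < c / 2"
    using c by (intro order_tendstoD) auto
  with K(2) have "\<forall>\<^sub>F x in at_right 0. c / 2 * x powr \<beta> \<le> f x \<and> f x \<le> 2 * c * x powr \<beta>"
    using eventually_at_right_less[of 0]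
  proof eventually_elim
    case (elim x)
    have "\<bar>f x - c * x powr \<beta>\<bar> \<le> (K * x powr \<delta>) * x powr \<beta>"
      using elim by (simp add: powr_add mult_ac)
    also have "\<dots> \<le> c / 2 * x powr \<beta>"
      using elim by (intro mult_right_mono) auto
    finally have "\<bar>f x - c * x powr \<beta>\<bar> \<le> c / 2 * x powr \<beta>" .
    moreover have "0 \<le> c * x powr \<beta>"
      using c by simp
    ultimately show ?case
      by (simp only: abs_le_iff) linarith
  qed
  then obtain r where r: "0 < r"
      "\<And>x. 0 < x \<Longrightarrow> x < r \<Longrightarrow> c / 2 * x powr \<beta> \<le> f x \<and> f x \<le> 2 * c * x powr \<beta>"
    unfolding eventually_at_right_field by blast
  show ?thesis
    by (rule that[of "min r 1"]) (use r in auto)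
qed

text \<open>An affine change of variables with slope -1. The target is switched from
  \<open>lborel\<close> to \<open>borel\<close>, which have the same measurable sets.\<close>

lemma distributed_reflect:
  fixes X :: "'a \<Rightarrow> real" and g :: "real \<Rightarrow> real"
  assumes M: "prob_space M" and X: "distributed M lborel X (\<lambda>x. ennreal (g x))"
  shows "distr M borel (\<lambda>\<omega>. 1 - X \<omega>) = density lborel (\<lambda>x. ennreal (g (1 - x)))"
proof -
  interpret prob_space M by (rule M)
  have "distributed M lborel (\<lambda>\<omega>. 1 + (- 1) * X \<omega>) (\<lambda>x. ennreal (g ((x - 1) / (- 1))) / ennreal \<bar>- 1\<bar>)"
    by (rule distributed_affine[OF X]) simp
  then have "distr M lborel (\<lambda>\<omega>. 1 - X \<omega>) = density lborel (\<lambda>x. ennreal (g (1 - x)))"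
    by (simp add: distributed_def divide_ennreal_def)
  moreover have "distr M lborel (\<lambda>\<omega>. 1 - X \<omega>) = distr M borel (\<lambda>\<omega>. 1 - X \<omega>)"
    by (rule distr_cong) simp_all
  ultimately show ?thesis by simp
qed

text \<open>Densities of equal measures agree almost everywhere, and the reflection of x to 1 - x
  preserves null sets.\<close>

lemma uniform_density_AE:
  fixes g :: "real \<Rightarrow> real"
  assumes [measurable]: "g \<in> borel_measurable borel" and nonneg: "\<And>x. 0 \<le> g x"
    and eq: "density lborel (\<lambda>x. ennreal (g x)) = uniform_measure lborel {0..1}"
  shows "AE x in lborel. 0 < x \<and> x < 1 \<longrightarrow> g (1 - x) = 1"
proof -
  have "density lborel (\<lambda>x. ennreal (g x)) = density lborel (indicator {0..1})"
    unfolding eq uniform_measure_def by (simp add: divide_ennreal_def)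
  then have "AE x in lborel. ennreal (g x) = indicator {0..1} x"
    by (subst (asm) sigma_finite_measure.density_unique_iff[OF sigma_finite_lborel]) auto
  then have "AE x in lborel. g x = indicator {0..1} x"
    by eventually_elim (use nonneg in \<open>auto split: split_indicator_asm split_indicator\<close>)
  then have "AE x in lborel. g (1 + (- 1) * x) = indicator {0..1} (1 + (- 1) * x)"
    by (intro AE_borel_affine) auto
  then show ?thesis
    by eventually_elim auto
qed

lemma measure_tendsto_1:
  assumes "\<And>n. n \<ge> 2 \<Longrightarrow> prob_space (M n)"
    and lower: "\<forall>\<^sub>F n in sequentially. 1 - e n \<le> measure (M n) (E n)"
    and e: "e \<longlonglongrightarrow> 0"
  shows "(\<lambda>n. measure (M n) (E n)) \<longlonglongrightarrow> (1 :: real)"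
proof (rule tendsto_sandwich[OF lower])
  show "\<forall>\<^sub>F n in sequentially. measure (M n) (E n) \<le> 1"
    using eventually_ge_at_top[of 2] by eventually_elim (simp add: assms(1) prob_space.prob_le_1)
  show "(\<lambda>n. 1 - e n) \<longlonglongrightarrow> 1"
    using tendsto_diff[OF tendsto_const e, of 1] by simp
qed simp

section \<open>Limits along a sequence of learners\<close>

locale learner_sequence = power_density f D \<beta> l u x\<^sub>0
  for f :: "real \<Rightarrow> real" and D :: "real measure" and \<beta> l u x\<^sub>0 :: real +
  fixes M :: "nat \<Rightarrow> 'w measure" and a :: "nat \<Rightarrow> nat \<Rightarrow> 'w \<Rightarrow> real" and \<Delta> :: real
  assumes learner_n: "n \<ge> 2 \<Longrightarrow> random_learner (M n) n (a n) D \<Delta>"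
    and l_pos: "0 < l" and u_pos: "0 < u"
    and Delta: "0 < \<Delta>" "\<Delta> < 1"
begin

lemma prob_space_M: "n \<ge> 2 \<Longrightarrow> prob_space (M n)"
  using learner_n by (auto simp: random_learner_def)

lemma lower_constant_pos: "0 < A \<Longrightarrow> 0 < (1 - \<Delta>) / (4 * A * \<bar>ln \<Delta>\<bar>)"
  using Delta by (intro divide_pos_pos mult_pos_pos) auto

lemma upper_constant_pos: "0 < C \<Longrightarrow> 0 < (C / \<Delta> + 1) / \<bar>ln \<Delta>\<bar>"
  using Delta by (intro divide_pos_pos add_pos_pos) auto

lemma tendsto_1_critical:
  assumes "\<beta> = 0"
  shows "\<exists>C\<^sub>1>0. \<exists>C\<^sub>2>0. (\<lambda>n. measure (M n)
    (rescaled_time_event (M n) n (a n) \<Delta> (real n * ln (real n)) C\<^sub>1 C\<^sub>2)) \<longlonglongrightarrow> 1"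
proof -
  \<comment> \<open>The level \<open>b\<close> is small enough for \<open>n * b\<close> to vanish,
    so that in the limit no value lies below it, yet large enough for the Chebyshev term, of order
    \<open>1 / sqrt (ln n)\<close>, to vanish. Since \<open>- ln b\<close> is asymptotic to
    \<open>ln n\<close>, the truncated mean is of order \<open>ln n\<close>.\<close>
  define s b t U L where
    "s = (\<lambda>n. real n * ln (real n))" and "b = (\<lambda>n. 1 / (real n * sqrt (ln (real n))))" and
    "t = (\<lambda>n. l / 4 * (real n * ln (real n)))" and
    "U = (\<lambda>n. 1 / x\<^sub>0 + u * (ln x\<^sub>0 - ln (1 / (real n * sqrt (ln (real n))))))" and
    "L = (\<lambda>n. l * (ln x\<^sub>0 - ln (1 / (real n * sqrt (ln (real n))))))"
  note defs = s_def b_def t_def U_def L_def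
  \<comment> \<open>The limits computed below are \<open>u + l / 4\<close> and
    \<open>3 / 4 * l\<close>; the constants \<open>C\<close> and \<open>1 / A = l / 2\<close> leave
    room on either side.\<close>
  define A C where "A = 2 / l" and "C = 2 * u + l"
  have AC: "0 < A" "0 < C"
    using l_pos u_pos by (simp_all add: A_def C_def)
  have "(\<lambda>n. (real n * U n + t n) / s n) \<longlonglongrightarrow> u + l / 4"
    unfolding defs using u_pos l_pos x\<^sub>0(1) by real_asymp
  then have ev_upper: "\<forall>\<^sub>F n in sequentially. (real n * U n + t n) / s n < C"
    using u_pos l_pos by (intro order_tendstoD) (auto simp: C_def)
  have "(\<lambda>n. ((real n - 1) * L n - t n) / s n) \<longlonglongrightarrow> l - l / 4"
    unfolding defs using u_pos l_pos x\<^sub>0(1) by real_asymp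
  then have ev_lower: "\<forall>\<^sub>F n in sequentially. l / 2 < ((real n - 1) * L n - t n) / s n"
    using l_pos by (intro order_tendstoD) auto
  have "(\<lambda>n. A / s n / b n) \<longlonglongrightarrow> 0"
    unfolding defs using AC by real_asymp
  then have ev_cutoff: "\<forall>\<^sub>F n in sequentially. A / s n / b n < (1 - \<Delta>) / 2"
    using Delta by (intro order_tendstoD) auto
  have "b \<longlonglongrightarrow> 0"
    unfolding defs by real_asymp
  then have ev_b: "\<forall>\<^sub>F n in sequentially. b n < x\<^sub>0"
    using x\<^sub>0 by (intro order_tendstoD) auto
  have ev_s: "\<forall>\<^sub>F n in sequentially. 1 \<le> s n"
    unfolding defs by real_asymp
  have ev_b0: "\<forall>\<^sub>F n in sequentially. 0 < b n"
    unfolding defs by real_asymp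
  have lim: "(\<lambda>n. real n * (u * b n) + real n * U n / (b n * (t n)\<^sup>2)) \<longlonglongrightarrow> 0"
    unfolding defs using u_pos l_pos x\<^sub>0(1) by real_asymp
  have "\<forall>\<^sub>F n in sequentially. 1 - (real n * (u * b n) + real n * U n / (b n * (t n)\<^sup>2))
      \<le> measure (M n) (rescaled_time_event (M n) n (a n) \<Delta> (s n)
           ((1 - \<Delta>) / (4 * A * \<bar>ln \<Delta>\<bar>)) ((C / \<Delta> + 1) / \<bar>ln \<Delta>\<bar>))"
    using ev_upper ev_lower ev_cutoff ev_b ev_s ev_b0 eventually_ge_at_top[of 2]
  proof eventually_elim
    case (elim n)
    interpret R: random_learner "M n" n "a n" D \<Delta>
      using learner_n elim by simp
    have G: "(ln has_real_derivative x powr (\<beta> - 1)) (at x)" if "0 < x" for x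
      using DERIV_ln_divide[OF that] that by (simp add: assms powr_minus_divide)
    show ?case
    proof (rule R.prob_learning_time_bounds_critical[where L = "L n"])
      show "0 < t n"
        using elim l_pos by (simp add: defs)
      show "measure D {..<b n} \<le> u * b n"
        using measure_lessThan_bounds(2)[of "b n"] elim by (simp add: assms)
      show "(\<integral>x. truncated_inverse (b n) x \<partial>D) \<le> U n" "L n \<le> (\<integral>x. truncated_inverse (b n) x \<partial>D)"
        using integral_truncated_inverse_bounds[OF _ _ G, of "b n"] elim
        by (simp_all add: U_def L_def b_def)
      show "real n * U n + t n \<le> C * s n"
        using elim by (simp add: field_simps)
      show "s n / A \<le> (real n - 1) * L n - t n"
        using elim by (simp add: A_def field_simps)
    qed (use elim AC in auto)
  qed
  then have "(\<lambda>n. measure (M n) (rescaled_time_event (M n) n (a n) \<Delta> (s n)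
           ((1 - \<Delta>) / (4 * A * \<bar>ln \<Delta>\<bar>)) ((C / \<Delta> + 1) / \<bar>ln \<Delta>\<bar>))) \<longlonglongrightarrow> 1"
    by (rule measure_tendsto_1[where M = M, rotated, OF _ lim prob_space_M])
  moreover have "0 < (1 - \<Delta>) / (4 * A * \<bar>ln \<Delta>\<bar>)" "0 < (C / \<Delta> + 1) / \<bar>ln \<Delta>\<bar>"
    using AC by (intro lower_constant_pos upper_constant_pos; simp)+
  ultimately show ?thesis
    unfolding s_def by blast
qed

lemma tendsto_1_light:
  assumes pos: "0 < \<beta>"
  shows "\<exists>C\<^sub>1>0. \<exists>C\<^sub>2>0. (\<lambda>n. measure (M n)
    (rescaled_time_event (M n) n (a n) \<Delta> (real n) C\<^sub>1 C\<^sub>2)) \<longlonglongrightarrow> 1"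
proof -
  \<comment> \<open>This exponent lies strictly between \<open>1 / (1 + \<beta>)\<close> and 1. The
    first inequality makes the expected number of values below \<open>b\<close> vanish, the second
    the Chebyshev term.\<close>
  define \<gamma> where "\<gamma> = 1 / (1 + \<beta> / 2)"
  have \<gamma>: "0 < \<gamma>" "\<gamma> < 1" "1 < \<gamma> * (\<beta> + 1)"
    using pos by (auto simp: \<gamma>_def field_simps)
  define b where "b = (\<lambda>n::nat. real n powr - \<gamma>)"
  \<comment> \<open>The contribution of the lower endpoint \<open>b\<close> is negative and gets
    dropped, so \<open>U\<close> bounds the truncated means uniformly in \<open>n\<close>.\<close>
  define U where "U = 1 / x\<^sub>0 + u * (x\<^sub>0 powr \<beta> / \<beta>)"
  define d where "d = (\<lambda>n. u * (b n powr (\<beta> + 1) / (\<beta> + 1)))"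
  have U0: "0 < U"
    using x\<^sub>0 u_pos pos by (auto simp: U_def intro!: add_pos_pos)
  have "b \<longlonglongrightarrow> 0"
    unfolding b_def using \<gamma> by (intro tendsto_neg_powr filterlim_real_sequentially) auto
  then have ev_b: "\<forall>\<^sub>F n in sequentially. b n < x\<^sub>0"
    using x\<^sub>0 by (intro order_tendstoD) auto
  have "(\<lambda>n. 2 / real n) \<longlonglongrightarrow> 0"
    by real_asymp
  then have ev_cutoff: "\<forall>\<^sub>F n in sequentially. 2 / real n < (1 - \<Delta>) / 2"
    using Delta by (intro order_tendstoD) auto
  have lim: "(\<lambda>n. u / (\<beta> + 1) * real n powr (1 - \<gamma> * (\<beta> + 1)) + U * real n powr (\<gamma> - 1)) \<longlonglongrightarrow> 0"
    using \<gamma> by (intro tendsto_add_zero tendsto_mult_right_zero tendsto_neg_powr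
      filterlim_real_sequentially) auto
  have "\<forall>\<^sub>F n in sequentially. 1 - (u / (\<beta> + 1) * real n powr (1 - \<gamma> * (\<beta> + 1)) + U * real n powr (\<gamma> - 1))
      \<le> measure (M n) (rescaled_time_event (M n) n (a n) \<Delta> (real n)
           ((1 - \<Delta>) / (4 * 2 * \<bar>ln \<Delta>\<bar>)) (((U + 1) / \<Delta> + 1) / \<bar>ln \<Delta>\<bar>))"
    using ev_b ev_cutoff eventually_ge_at_top[of 2]
  proof eventually_elim
    case (elim n)
    interpret R: random_learner "M n" n "a n" D \<Delta>
      using learner_n elim by simp
    have b0: "0 < b n"
      using elim by (simp add: b_def)
    have G: "((\<lambda>x. x powr \<beta> / \<beta>) has_real_derivative x powr (\<beta> - 1)) (at x)" if "0 < x" for x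
      using has_real_derivative_powr[OF that, of \<beta>] pos by (auto dest: DERIV_cdivide[of _ _ _ _ \<beta>])
    have "real n * d n = u / (\<beta> + 1) * (real n powr 1 * real n powr (- \<gamma> * (\<beta> + 1)))"
      using elim by (simp add: d_def b_def powr_powr)
    then have eq1: "real n * d n = u / (\<beta> + 1) * real n powr (1 - \<gamma> * (\<beta> + 1))"
      by (simp only: powr_add[symmetric]) simp
    have "real n * U / (b n * (real n)\<^sup>2) = U * real n powr (\<gamma> - 1)"
      using elim by (simp add: b_def powr_diff powr_minus power2_eq_square field_simps)
    note eqs = eq1 this
    have "1 - (real n * d n + real n * U / (b n * (real n)\<^sup>2))
      \<le> measure (M n) (rescaled_time_event (M n) n (a n) \<Delta> (real n)
           ((1 - \<Delta>) / (4 * 2 * \<bar>ln \<Delta>\<bar>)) (((U + 1) / \<Delta> + 1) / \<bar>ln \<Delta>\<bar>))"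
    proof (rule R.prob_learning_time_bounds_light)
      show "measure D {..<b n} \<le> d n"
        using measure_lessThan_bounds(2)[of "b n"] elim b0 by (simp add: d_def)
      have "u * (x\<^sub>0 powr \<beta> / \<beta> - b n powr \<beta> / \<beta>) \<le> u * (x\<^sub>0 powr \<beta> / \<beta>)"
        using u_pos pos by (intro mult_left_mono) auto
      then show "(\<integral>x. truncated_inverse (b n) x \<partial>D) \<le> U"
        using integral_truncated_inverse_bounds(2)[OF _ _ G, of "b n"] elim b0
        unfolding U_def by linarith
    qed (use elim U0 b0 in \<open>auto simp: algebra_simps\<close>)
    then show ?case
      unfolding eqs .
  qed
  then have "(\<lambda>n. measure (M n) (rescaled_time_event (M n) n (a n) \<Delta> (real n)
           ((1 - \<Delta>) / (4 * 2 * \<bar>ln \<Delta>\<bar>)) (((U + 1) / \<Delta> + 1) / \<bar>ln \<Delta>\<bar>))) \<longlonglongrightarrow> 1"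
    by (rule measure_tendsto_1[where M = M, rotated, OF _ lim prob_space_M])
  moreover have "0 < (1 - \<Delta>) / (4 * 2 * \<bar>ln \<Delta>\<bar>)" "0 < ((U + 1) / \<Delta> + 1) / \<bar>ln \<Delta>\<bar>"
    using U0 by (intro lower_constant_pos upper_constant_pos; simp)+
  ultimately show ?thesis
    by blast
qed

text \<open>The constants depend on \<open>e\<close>, which is split into thirds: for a value below
  \<open>y / s n\<close>, for a large truncated sum, and for too few values below
  \<open>A / s n\<close>.\<close>

lemma tight_heavy:
  assumes neg: "\<beta> < 0" and e: "0 < e"
  shows "\<exists>C\<^sub>1>0. \<exists>C\<^sub>2>0. \<forall>\<^sub>F n in sequentially. 1 - e \<le> measure (M n)
    (rescaled_time_event (M n) n (a n) \<Delta> (real n powr (1 / (1 + \<beta>))) C\<^sub>1 C\<^sub>2)"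
proof -
  define \<kappa> where "\<kappa> = 1 + \<beta>"
  have \<kappa>: "0 < \<kappa>" "\<kappa> < 1" "\<beta> + 1 = \<kappa>" "\<beta> = \<kappa> - 1"
    using neg \<beta> by (simp_all add: \<kappa>_def)
  define s where "s = (\<lambda>n. real n powr (1 / \<kappa>))"
  \<comment> \<open>Chosen so that \<open>n * u * b powr \<kappa> / \<kappa> = e / 3\<close> for
    \<open>b = y / s n\<close>, using \<open>s n powr \<kappa> = n\<close>.\<close>
  define y where "y = (e * \<kappa> / (3 * u)) powr (1 / \<kappa>)"
  \<comment> \<open>\<open>W * s n\<close> bounds \<open>n\<close> times the truncated mean; the
    constant \<open>C\<close> then turns the Markov bound into \<open>e / 3\<close>.\<close>
  define W where "W = 1 / x\<^sub>0 + u * (y powr \<beta> / (- \<beta>))"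
  define C where "C = 3 * W / e"
  \<comment> \<open>The first entry provides enough values below \<open>A / s n\<close>, the second
    makes the Chebyshev term at most \<open>e / 3\<close>. Then \<open>A\<close> solves
    \<open>l * (A / s n) powr \<kappa> / \<kappa> = 2 * Q / n\<close>, where the factor 2 pays for
    \<open>n - 1 \<ge> n / 2\<close>.\<close>
  define Q where "Q = max (4 / (1 - \<Delta>)) (12 / e)"
  define A where "A = (2 * \<kappa> * Q / l) powr (1 / \<kappa>)"
  have y: "0 < y" "y powr \<kappa> = e * \<kappa> / (3 * u)"
    using e u_pos \<kappa> by (simp_all add: y_def powr_powr)
  have W: "0 < W"
    unfolding W_def using x\<^sub>0 u_pos y neg
    by (intro add_pos_pos mult_pos_pos divide_pos_pos) auto
  have C: "0 < C"
    using W e by (simp add: C_def)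
  have Q: "0 < Q" "4 / (1 - \<Delta>) \<le> Q" "12 / e \<le> Q"
    using e by (auto simp: Q_def less_max_iff_disj)
  have A: "0 < A" "A powr \<kappa> = 2 * \<kappa> * Q / l"
    using Q(1) l_pos \<kappa> by (simp_all add: A_def powr_powr)
  have s_lim: "filterlim s at_top sequentially"
    unfolding s_def using \<kappa> by real_asymp
  have "(\<lambda>n. y / s n) \<longlonglongrightarrow> 0" "(\<lambda>n. A / s n) \<longlonglongrightarrow> 0"
    by (intro tendsto_divide_0[OF tendsto_const] filterlim_at_top_imp_at_infinity s_lim)+
  then have ev: "\<forall>\<^sub>F n in sequentially. y / s n < x\<^sub>0" "\<forall>\<^sub>F n in sequentially. A / s n < x\<^sub>0"
    using x\<^sub>0 by (auto intro: order_tendstoD)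
  have "\<forall>\<^sub>F n in sequentially. 1 - e
      \<le> measure (M n) (rescaled_time_event (M n) n (a n) \<Delta> (s n)
           ((1 - \<Delta>) / (4 * A * \<bar>ln \<Delta>\<bar>)) ((C / \<Delta> + 1) / \<bar>ln \<Delta>\<bar>))"
    using ev eventually_ge_at_top[of 2]
  proof eventually_elim
    case (elim n)
    interpret R: random_learner "M n" n "a n" D \<Delta>
      using learner_n elim by simp
    have n: "1 \<le> real n"
      using elim by simp
    have s_\<kappa>: "s n powr \<kappa> = real n"
      using \<kappa> n by (simp add: s_def powr_powr)
    have s_pos: "0 < s n"
      using n by (simp add: s_def)
    have n_le_s: "real n \<le> s n"
      using powr_mono[of 1 "1 / \<kappa>" "real n"] \<kappa> n by (simp add: s_def)
    have s_\<beta>: "s n powr \<beta> * s n = real n"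
      using s_\<kappa> s_pos \<kappa>(4) by (simp add: powr_diff)
    have G: "((\<lambda>x. x powr \<beta> / \<beta>) has_real_derivative x powr (\<beta> - 1)) (at x)" if "0 < x" for x
      using has_real_derivative_powr[OF that, of \<beta>] neg by (auto dest: DERIV_cdivide[of _ _ _ _ \<beta>])
    define d where "d = e / (3 * real n)"
    define U where "U = 1 / x\<^sub>0 + u * (y powr \<beta> / (- \<beta>)) * (s n / real n)"
    define q where "q = 2 * Q / real n"
    have "1 - (real n * d + real n * U / (C * s n) + 4 / ((real n - 1) * q))
        \<le> measure (M n) (rescaled_time_event (M n) n (a n) \<Delta> (s n)
           ((1 - \<Delta>) / (4 * A * \<bar>ln \<Delta>\<bar>)) ((C / \<Delta> + 1) / \<bar>ln \<Delta>\<bar>))"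
    proof (rule R.prob_learning_time_bounds_heavy[where b = "y / s n" and h = "A / s n"])
      have "u * ((y / s n) powr (\<beta> + 1) / (\<beta> + 1)) = d"
        using y u_pos \<kappa> e n s_pos by (simp add: powr_divide s_\<kappa> d_def field_simps)
      then show "measure D {..<y / s n} \<le> d"
        using measure_lessThan_bounds(2)[of "y / s n"] elim y s_pos by simp
      have "(y / s n) powr \<beta> = y powr \<beta> * (s n / real n)"
        using y s_pos n s_\<beta> by (simp add: powr_divide field_simps)
      then have "U = 1 / x\<^sub>0 + u * (- ((y / s n) powr \<beta> / \<beta>))"
        by (simp add: U_def mult_ac)
      moreover have "u * (x\<^sub>0 powr \<beta> / \<beta> - (y / s n) powr \<beta> / \<beta>) \<le> u * (- ((y / s n) powr \<beta> / \<beta>))"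
        using u_pos neg by (intro mult_left_mono) (auto simp: divide_nonneg_neg)
      ultimately show "(\<integral>x. truncated_inverse (y / s n) x \<partial>D) \<le> U"
        using integral_truncated_inverse_bounds(2)[OF _ _ G, of "y / s n"] elim y s_pos by simp
      have "l * ((A / s n) powr (\<beta> + 1) / (\<beta> + 1)) = q"
        using A l_pos \<kappa> n s_pos by (simp add: powr_divide s_\<kappa> q_def field_simps)
      then show "q \<le> measure D {..<A / s n}"
        using measure_lessThan_bounds(1)[of "A / s n"] elim A s_pos by simp
      have "Q \<le> (real n - 1) * q"
        using Q elim by (simp add: q_def field_simps)
      then show "4 / (1 - \<Delta>) \<le> (real n - 1) * q"
        using Q by simp
    qed (use A C y n n_le_s s_pos in auto)
    moreover have "real n * d = e / 3"
      using n by (simp add: d_def)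
    moreover have "real n * U / (C * s n) \<le> e / 3"
    proof -
      have "real n * U = real n / x\<^sub>0 + u * (y powr \<beta> / (- \<beta>)) * s n"
        using n by (simp add: U_def field_simps)
      also have "\<dots> \<le> s n / x\<^sub>0 + u * (y powr \<beta> / (- \<beta>)) * s n"
        using n_le_s x\<^sub>0 by (intro add_right_mono divide_right_mono) auto
      also have "\<dots> = W * s n"
        by (simp add: W_def algebra_simps)
      finally have "real n * U / (C * s n) \<le> W * s n / (C * s n)"
        using C s_pos by (intro divide_right_mono) auto
      also have "\<dots> = e / 3"
        using W s_pos e by (simp add: C_def)
      finally show ?thesis .
    qed
    moreover have "4 / ((real n - 1) * q) \<le> e / 3"
    proof -
      have "Q \<le> (real n - 1) * q"
        using Q elim by (simp add: q_def field_simps)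
      then have "12 / e \<le> (real n - 1) * q"
        using Q by simp
      moreover have "0 < (real n - 1) * q"
        using Q(1) elim by (simp add: q_def)
      ultimately show ?thesis
        using e by (simp add: field_simps)
    qed
    ultimately show ?case
      by linarith
  qed
  moreover have "0 < (1 - \<Delta>) / (4 * A * \<bar>ln \<Delta>\<bar>)" "0 < (C / \<Delta> + 1) / \<bar>ln \<Delta>\<bar>"
    using A C by (intro lower_constant_pos upper_constant_pos; simp)+
  ultimately show ?thesis
    unfolding s_def \<kappa>_def by blast
qed

text \<open>Tightness with \<open>e = 1 - r\<close> gives probability at least \<open>r\<close> to
  one fixed interval, which the interval from \<open>1 / x\<close> to \<open>x\<close> contains for
  large \<open>x\<close>. From above, probabilities are at most 1.\<close>

lemma liminf_tendsto_1_heavy: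
  assumes neg: "\<beta> < 0"
  shows "((\<lambda>x. liminf (\<lambda>n. ereal (measure (M n)
    (rescaled_time_event (M n) n (a n) \<Delta> (real n powr (1 / (1 + \<beta>))) (1 / x) x)))) \<longlongrightarrow> 1) at_top"
    (is "((\<lambda>x. liminf (\<lambda>n. ereal (?p n (1 / x) x))) \<longlongrightarrow> 1) at_top")
proof (rule order_tendstoI)
  fix z :: ereal assume "z < 1"
  then obtain r :: real where r: "z < ereal r" "r < 1"
    using ereal_dense2[of z 1] by auto
  then obtain C\<^sub>1 C\<^sub>2 where C: "0 < C\<^sub>1" "0 < C\<^sub>2"
      "\<forall>\<^sub>F n in sequentially. 1 - (1 - r) \<le> ?p n C\<^sub>1 C\<^sub>2"
    using tight_heavy[OF neg, of "1 - r"] by auto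
  have "\<forall>\<^sub>F x in at_top. max (1 / C\<^sub>1) C\<^sub>2 \<le> (x :: real)"
    by (rule eventually_ge_at_top)
  then show "\<forall>\<^sub>F x in at_top. z < liminf (\<lambda>n. ereal (?p n (1 / x) x))"
  proof eventually_elim
    case (elim x)
    have "0 < x"
      using C(2) elim by simp
    then have x: "1 / x \<le> C\<^sub>1" "C\<^sub>2 \<le> x"
      using C(1) elim by (simp_all add: field_simps)
    have "\<forall>\<^sub>F n in sequentially. ereal r \<le> ereal (?p n (1 / x) x)"
      using C(3) eventually_ge_at_top[of 2]
    proof eventually_elim
      case (elim n)
      interpret R: random_learner "M n" n "a n" D \<Delta>
        using learner_n elim by simp
      have "?p n C\<^sub>1 C\<^sub>2 \<le> ?p n (1 / x) x"
        using x by (intro R.finite_measure_mono R.rescaled_time_event_measurable)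
          (auto simp: rescaled_time_event_def)
      then show ?case
        using elim by simp
    qed
    then have "ereal r \<le> liminf (\<lambda>n. ereal (?p n (1 / x) x))"
      by (rule Liminf_bounded)
    then show ?case
      using r(1) by (rule less_le_trans[rotated])
  qed
next
  fix z :: ereal assume z: "1 < z"
  have "liminf (\<lambda>n. ereal (?p n (1 / x) x)) < z" for x
  proof -
    have "\<forall>\<^sub>F n in sequentially. ereal (?p n (1 / x) x) \<le> 1"
      using eventually_ge_at_top[of 2]
      by eventually_elim (simp add: prob_space.prob_le_1 prob_space_M one_ereal_def)
    then have "liminf (\<lambda>n. ereal (?p n (1 / x) x)) \<le> 1"
      by (intro Liminf_le) auto
    then show ?thesis
      using z by simp
  qed
  then show "\<forall>\<^sub>F x in at_top. liminf (\<lambda>n. ereal (?p n (1 / x) x)) < z"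
    by simp
qed

end


section \<open>The three regimes of the overlap density\<close>

theorem theoremA:
  fixes M :: "nat \<Rightarrow> 'w measure"
    and a :: "nat \<Rightarrow> nat \<Rightarrow> 'w \<Rightarrow> real"
    and ft f :: "real \<Rightarrow> real"
    and \<Delta> :: real
  assumes Delta: "0 < \<Delta>" "\<Delta> < 1"
    and prob_space: "\<And>n. n \<ge> 2 \<Longrightarrow> prob_space (M n)"
    and first: "\<And>n \<omega>. n \<ge> 2 \<Longrightarrow> \<omega> \<in> space (M n) \<Longrightarrow> a n 1 \<omega> = 1"
    and range: "\<And>n i \<omega>. n \<ge> 2 \<Longrightarrow> i \<in> {2..n} \<Longrightarrow> \<omega> \<in> space (M n) \<Longrightarrow> a n i \<omega> \<in> {0..1}"
    and indep: "\<And>n. n \<ge> 2 \<Longrightarrow> prob_space.indep_vars (M n) (\<lambda>_. borel) (a n) {2..n}"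
    and nonneg: "\<And>x. 0 \<le> ft x"
    and distributed: "\<And>n i. n \<ge> 2 \<Longrightarrow> i \<in> {2..n} \<Longrightarrow>
           distributed (M n) lborel (a n i) (\<lambda>x. ennreal (ft x))"
    and f: "\<And>x. f x = ft (1 - x)"
  shows
    "(density lborel (\<lambda>x. ennreal (ft x)) = uniform_measure lborel {0..1} \<or>
      (\<exists>c>0. \<exists>\<delta>>0. (\<lambda>x. f x - c) \<in> O[at_right 0](\<lambda>x. x powr \<delta>)) \<longrightarrow>
      (\<exists>C\<^sub>1>0. \<exists>C\<^sub>2>0.
         (\<lambda>n. measure (M n) {\<omega> \<in> space (M n).
              C\<^sub>1 < real (learning_time n (\<lambda>i. a n i \<omega>) \<Delta>) / (\<bar>ln \<Delta>\<bar> * real n * ln (real n)) \<and>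
              real (learning_time n (\<lambda>i. a n i \<omega>) \<Delta>) / (\<bar>ln \<Delta>\<bar> * real n * ln (real n)) < C\<^sub>2})
         \<longlonglongrightarrow> 1))
   \<and> (\<forall>c \<delta> \<beta>. c > 0 \<and> \<delta> > 0 \<and> \<beta> > 0 \<and>
        (\<lambda>x. f x - c * x powr \<beta>) \<in> O[at_right 0](\<lambda>x. x powr (\<beta> + \<delta>)) \<longrightarrow>
      (\<exists>C\<^sub>1>0. \<exists>C\<^sub>2>0.
         (\<lambda>n. measure (M n) {\<omega> \<in> space (M n).
              C\<^sub>1 < real (learning_time n (\<lambda>i. a n i \<omega>) \<Delta>) / (\<bar>ln \<Delta>\<bar> * real n) \<and>
              real (learning_time n (\<lambda>i. a n i \<omega>) \<Delta>) / (\<bar>ln \<Delta>\<bar> * real n) < C\<^sub>2})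
         \<longlonglongrightarrow> 1))
   \<and> (\<forall>c \<delta> \<beta>. c > 0 \<and> \<delta> > 0 \<and> -1 < \<beta> \<and> \<beta> < 0 \<and>
        (\<lambda>x. f x - c * x powr \<beta>) \<in> O[at_right 0](\<lambda>x. x powr (\<beta> + \<delta>)) \<longrightarrow>
      ((\<lambda>x::real. liminf (\<lambda>n. ereal (measure (M n) {\<omega> \<in> space (M n).
              1 / x < real (learning_time n (\<lambda>i. a n i \<omega>) \<Delta>) / (\<bar>ln \<Delta>\<bar> * real n powr (1 / (1 + \<beta>))) \<and>
              real (learning_time n (\<lambda>i. a n i \<omega>) \<Delta>) / (\<bar>ln \<Delta>\<bar> * real n powr (1 / (1 + \<beta>))) < x})))
         \<longlongrightarrow> 1) at_top)"
proof -
  \<comment> \<open>The space \<open>M 2\<close> carries one random overlap, with index 2; the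
    measurability of \<open>ft\<close> and the basic properties of \<open>D\<close> are read off
    from it.\<close>
  interpret M2: prob_space "M 2"
    by (rule prob_space) simp
  define D where "D = density lborel (\<lambda>x. ennreal (f x))"
  have "(\<lambda>x. ennreal (ft x)) \<in> borel_measurable borel"
    using distributed[of 2 2] by (simp add: distributed_def)
  \<comment> \<open>The assumption yields measurability only after the embedding by
    \<open>ennreal\<close>; nonnegativity lets \<open>enn2real\<close> undo it.\<close>
  then have "(\<lambda>x. enn2real (ennreal (ft x))) \<in> borel_measurable borel"
    by measurable
  then have ft_measurable [measurable]: "ft \<in> borel_measurable borel"
    using nonneg by simp
  have f_measurable [measurable]: "f \<in> borel_measurable borel"
    unfolding f by measurable
  have f_nonneg: "0 \<le> f x" for x
    by (simp add: f nonneg)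
  have distr: "distr (M n) borel (\<lambda>\<omega>. 1 - a n i \<omega>) = D" if "n \<ge> 2" "i \<in> {2..n}" for n i
    unfolding D_def f by (rule distributed_reflect[OF prob_space distributed]) (use that in auto)
  have rv: "a 2 2 \<in> borel_measurable (M 2)"
    using distributed[of 2 2] by (simp add: distributed_def)
  have D_prob: "prob_space D"
    unfolding distr[of 2 2, simplified, symmetric]
    by (rule M2.prob_space_distr) (use rv in measurable)
  \<comment> \<open>Overlaps never exceed 1, which excludes negative values; the density excludes an
    atom at 0.\<close>
  have D_nonpos: "measure D {..0} = 0"
  proof -
    have "(\<lambda>\<omega>. 1 - a 2 2 \<omega>) -` {..<0} \<inter> space (M 2) = {}"
      using range[of 2 2] by fastforce
    then have "emeasure D {..<0} = 0"
      unfolding distr[of 2 2, simplified, symmetric] using rv by (subst emeasure_distr) auto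
    moreover have "emeasure D {0} = 0"
      unfolding D_def by (subst emeasure_density) (auto simp: nn_integral_indicator_singleton)
    moreover have "{..0} = {..<0} \<union> {0::real}"
      by auto
    ultimately have "emeasure D {..0} = 0"
      using emeasure_subadditive[of "{..<0}" D "{0}"] by (simp add: D_def)
    then show ?thesis
      by (simp add: measure_def)
  qed
  have learner: "random_learner (M n) n (a n) D \<Delta>" if "n \<ge> 2" for n
    by (intro random_learner.intro random_learner_axioms.intro prob_space[OF that] that Delta
        indep[OF that] first[OF that] range[OF that] distr[OF that])
  have sequence: "learner_sequence f D \<beta> l u x\<^sub>0 M a \<Delta>"
    if "- 1 < \<beta>" "0 < l" "0 < u" "0 < x\<^sub>0" "x\<^sub>0 \<le> 1"
      "AE x in lborel. 0 < x \<and> x < x\<^sub>0 \<longrightarrow> l * x powr \<beta> \<le> f x \<and> f x \<le> u * x powr \<beta>"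
    for \<beta> l u x\<^sub>0
    by (intro learner_sequence.intro power_density.intro learner_sequence_axioms.intro
        f_measurable f_nonneg D_def D_prob D_nonpos learner Delta that)
  have sequence_bigo: "\<exists>l u x\<^sub>0. learner_sequence f D \<beta> l u x\<^sub>0 M a \<Delta>"
    if hyps: "0 < c" "0 < \<delta>" "- 1 < \<beta>" "(\<lambda>x. f x - c * x powr \<beta>) \<in> O[at_right 0](\<lambda>x. x powr (\<beta> + \<delta>))"
    for c \<delta> \<beta>
  proof -
    obtain x\<^sub>0 where "0 < x\<^sub>0" "x\<^sub>0 \<le> 1"
      "\<And>x. 0 < x \<Longrightarrow> x < x\<^sub>0 \<Longrightarrow> c / 2 * x powr \<beta> \<le> f x \<and> f x \<le> 2 * c * x powr \<beta>"
      using powr_bounds_of_bigo[OF hyps(1,2,4)] by blast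
    then have "learner_sequence f D \<beta> (c / 2) (2 * c) x\<^sub>0 M a \<Delta>"
      using hyps by (intro sequence AE_I2) auto
    then show ?thesis
      by blast
  qed
  show ?thesis
  proof (intro conjI allI impI)
    assume "density lborel (\<lambda>x. ennreal (ft x)) = uniform_measure lborel {0..1} \<or>
      (\<exists>c>0. \<exists>\<delta>>0. (\<lambda>x. f x - c) \<in> O[at_right 0](\<lambda>x. x powr \<delta>))"
    then have "\<exists>l u x\<^sub>0. learner_sequence f D 0 l u x\<^sub>0 M a \<Delta>"
    proof (elim disjE exE conjE)
      assume "density lborel (\<lambda>x. ennreal (ft x)) = uniform_measure lborel {0..1}"
      from uniform_density_AE[OF ft_measurable nonneg this]
      have "AE x in lborel. 0 < x \<and> x < 1 \<longrightarrow> 1 * x powr 0 \<le> f x \<and> f x \<le> 1 * x powr 0"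
        by eventually_elim (simp add: f)
      then have "learner_sequence f D 0 1 1 1 M a \<Delta>"
        by (intro sequence) auto
      then show ?thesis
        by blast
    next
      fix c \<delta> :: real
      assume c: "0 < c" "0 < \<delta>" and bigo: "(\<lambda>x. f x - c) \<in> O[at_right 0](\<lambda>x. x powr \<delta>)"
      \<comment> \<open>As \<open>0 powr 0\<close> is 0, the two sides differ at 0, a point that
        \<open>at_right 0\<close> ignores.\<close>
      have "\<forall>\<^sub>F x in at_right 0. f x - c = f x - c * x powr 0"
        using eventually_at_right_less[of 0] by eventually_elim simp
      then have "(\<lambda>x. f x - c * x powr 0) \<in> O[at_right 0](\<lambda>x. x powr (0 + \<delta>))"
        using bigo by (subst landau_o.big.in_cong[symmetric]) auto
      then show ?thesis
        using c by (intro sequence_bigo) auto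
    qed
    then obtain l u x\<^sub>0 where "learner_sequence f D 0 l u x\<^sub>0 M a \<Delta>"
      by blast
    then show "\<exists>C\<^sub>1>0. \<exists>C\<^sub>2>0.
         (\<lambda>n. measure (M n) {\<omega> \<in> space (M n).
              C\<^sub>1 < real (learning_time n (\<lambda>i. a n i \<omega>) \<Delta>) / (\<bar>ln \<Delta>\<bar> * real n * ln (real n)) \<and>
              real (learning_time n (\<lambda>i. a n i \<omega>) \<Delta>) / (\<bar>ln \<Delta>\<bar> * real n * ln (real n)) < C\<^sub>2})
         \<longlonglongrightarrow> 1"
      \<comment> \<open>The statement brackets the denominator to the left, whereas the event keeps
        the scale \<open>n * ln n\<close> as one factor; \<open>mult.assoc\<close> reconciles
        them.\<close>
      using learner_sequence.tendsto_1_critical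
      unfolding rescaled_time_event_def mult.assoc by blast
  next
    fix c \<delta> \<beta> :: real
    assume *: "c > 0 \<and> \<delta> > 0 \<and> \<beta> > 0 \<and>
        (\<lambda>x. f x - c * x powr \<beta>) \<in> O[at_right 0](\<lambda>x. x powr (\<beta> + \<delta>))"
    then have "\<exists>l u x\<^sub>0. learner_sequence f D \<beta> l u x\<^sub>0 M a \<Delta>"
      by (intro sequence_bigo[of c \<delta>]) auto
    then show "\<exists>C\<^sub>1>0. \<exists>C\<^sub>2>0.
         (\<lambda>n. measure (M n) {\<omega> \<in> space (M n).
              C\<^sub>1 < real (learning_time n (\<lambda>i. a n i \<omega>) \<Delta>) / (\<bar>ln \<Delta>\<bar> * real n) \<and>
              real (learning_time n (\<lambda>i. a n i \<omega>) \<Delta>) / (\<bar>ln \<Delta>\<bar> * real n) < C\<^sub>2})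
         \<longlonglongrightarrow> 1"
      using learner_sequence.tendsto_1_light *
      unfolding rescaled_time_event_def by blast
  next
    fix c \<delta> \<beta> :: real
    assume *: "c > 0 \<and> \<delta> > 0 \<and> -1 < \<beta> \<and> \<beta> < 0 \<and>
        (\<lambda>x. f x - c * x powr \<beta>) \<in> O[at_right 0](\<lambda>x. x powr (\<beta> + \<delta>))"
    then have "\<exists>l u x\<^sub>0. learner_sequence f D \<beta> l u x\<^sub>0 M a \<Delta>"
      by (intro sequence_bigo[of c \<delta>]) auto
    then show "((\<lambda>x::real. liminf (\<lambda>n. ereal (measure (M n) {\<omega> \<in> space (M n).
              1 / x < real (learning_time n (\<lambda>i. a n i \<omega>) \<Delta>) / (\<bar>ln \<Delta>\<bar> * real n powr (1 / (1 + \<beta>))) \<and>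
              real (learning_time n (\<lambda>i. a n i \<omega>) \<Delta>) / (\<bar>ln \<Delta>\<bar> * real n powr (1 / (1 + \<beta>))) < x})))
         \<longlongrightarrow> 1) at_top"
      using learner_sequence.liminf_tendsto_1_heavy *
      unfolding rescaled_time_event_def by blast
  qed
qed

end
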